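(* Let $\mathcal{P}$ be a ladder polyomino and let $K$ be a field. Then the polyomino ideal $I_{\mathcal{P}}\subset S=K[x_a\mid a\in V(\mathcal{P})]$ is a Knutson ideal.
   Context: $\mathbb{N}$ is the set of nonnegative integers, and $(i,j)\le (k,l)$ in $\mathbb{N}^2$ means $i\le k$ and $j\le l$. For $a=(i,j)\le b=(k,l)$ put $[a,b]=\{m\in\mathbb{N}^2: a\le m\le b\}$; it is a proper interval if $i<k$ and $j<l$. The diagonal vertices of a proper interval are $a$ (lower-left) and $b$ (upper-right), and its anti-diagonal vertices are $(i,l)$ (upper-left) and $(k,j)$ (lower-right). A cell is $C=[a,a+(1,1)]$; $V(C)$ is the set of its four vertices and its edges are the four pairs of adjacent vertices. For a finite collection of cells $\mathcal{P}$, $V(\mathcal{P})=\bigcup_{C\in\mathcal{P}}V(C)$. A polyomino is a non-empty finite collection of cells in $(\mathbb{N}\setminus\{0\})^2$ such that any two of its cells $C,D$ are joined by a sequence of cells $C=C_1,\dots,C_m=D$ of the collection with $C_i\cap C_{i+1}$ an edge of both for all $i$. A polyomino $\mathcal{P}$ is horizontally convex if whenever two cells of $\mathcal{P}$ have lower-left vertices $(i,j)$ and $(k,j)$ with $k>i$, every cell with lower-left vertex $(l,j)$, $i\le l\le k$, belongs to $\mathcal{P}$. Left-most vertices: for a horizontally convex polyomino $\mathcal{P}$, the set of left-most vertices is the set $\{a_1=(a_{1,1},a_{1,2}),\dots,a_r=(a_{r,1},a_{r,2})\}\subset V(\mathcal{P})$, with $a_{1,2}<a_{2,2}<\dots<a_{r,2}$,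 such that every $v=(v_1,v_2)\in V(\mathcal{P})$ is either some $a_i$, or there is $j$ with $v_2=a_{j,2}$ and $a_{j,1}<v_1$. Ladder polyomino: a horizontally convex polyomino with left-most vertices $\{a_1,\dots,a_r\}$ such that for each $2\le i\le r$, $a_i$ is the upper-left vertex of a cell in $\mathcal{P}$. An inner interval of $\mathcal{P}$ is a proper interval $[a,b]$ with $a,b\in V(\mathcal{P})$ all of whose cells belong to $\mathcal{P}$. $I_{\mathcal{P}}$ is the ideal of $S$ generated by all binomials $x_ax_b-x_cx_d$, where $[a,b]$ ranges over the inner intervals of $\mathcal{P}$ and $c,d$ are the anti-diagonal vertices of $[a,b]$. Knutson ideals: let $f\in S$ be such that $\operatorname{in}_<(f)$ is a square-free monomial for some monomial order $<$ on $S$. $\mathcal{C}_f$ is the smallest set of ideals of $S$ such that: (1) $(f)\in\mathcal{C}_f$; (2) if $I\in\mathcal{C}_f$ and $J$ is any ideal of $S$, then $I:J\in\mathcal{C}_f$; (3) if $I,J\in\mathcal{C}_f$, then $I+J\in\mathcal{C}_f$ and $I\cap J\in\mathcal{C}_f$. An ideal is a Knutson ideal if it lies in $\mathcal{C}_f$ for some such $f$. *)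

theory Defs
  imports
    "HOL-Algebra.Ideal"
    "HOL-Library.Poly_Mapping"
    "HOL-Library.Product_Order"
begin

section \<open>Polyominoes\<close>

text \<open>
  Points of the grid are pairs of natural numbers with the componentwise order and addition of
  \<^theory>\<open>HOL-Library.Product_Order\<close>, so that \<^term>\<open>{a..b}\<close> is the interval \<open>[a, b]\<close>.
\<close>

type_synonym point = "nat \<times> nat"

definition proper_interval :: "point \<Rightarrow> point \<Rightarrow> bool" where
  "proper_interval a b \<longleftrightarrow> fst a < fst b \<and> snd a < snd b"

definition upper_left :: "point \<Rightarrow> point \<Rightarrow> point" where
  "upper_left a b = (fst a, snd b)"

definition lower_right :: "point \<Rightarrow> point \<Rightarrow> point" where
  "lower_right a b = (fst b, snd a)"

definition cell :: "point \<Rightarrow> point set" where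
  "cell a = {a..a + (1, 1)}"

text \<open>The interval \<^term>\<open>cell a\<close> consists exactly of its four vertices.\<close>

lemma cell_eq: "cell a = {a, a + (1, 0), a + (0, 1), a + (1, 1)}"
  by (cases a) (auto simp: cell_def)

definition edges :: "point set \<Rightarrow> point set set" where
  "edges C = (\<Union>a \<in> {a. C = cell a}.
     {{a, a + (1, 0)}, {a, a + (0, 1)}, {a + (1, 0), a + (1, 1)}, {a + (0, 1), a + (1, 1)}})"

text \<open>Since a cell is the set of its vertices, the vertex set of a collection of cells is its union.\<close>

definition vertices :: "point set set \<Rightarrow> point set" where
  "vertices P = \<Union>P"

definition adjacent_cells :: "point set set \<Rightarrow> (point set \<times> point set) set" where
  "adjacent_cells P = {(C, D). C \<in> P \<and> D \<in> P \<and> C \<inter> D \<in> edges C \<and> C \<inter> D \<in> edges D}"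

definition polyomino :: "point set set \<Rightarrow> bool" where
  "polyomino P \<longleftrightarrow> finite P \<and> P \<noteq> {} \<and> P \<subseteq> cell ` {(1, 1)..} \<and>
     (\<forall>C \<in> P. \<forall>D \<in> P. (C, D) \<in> (adjacent_cells P)\<^sup>*)"

definition horizontally_convex :: "point set set \<Rightarrow> bool" where
  "horizontally_convex P \<longleftrightarrow> (\<forall>i j k. cell (i, j) \<in> P \<and> cell (k, j) \<in> P \<and> i < k \<longrightarrow>
     (\<forall>l \<in> {i..k}. cell (l, j) \<in> P))"

text \<open>
  The left-most vertices are given as the list of the \<open>a\<^sub>i\<close> in order of increasing height. The list
  is determined by \<open>P\<close>.
\<close>

definition leftmost_vertices :: "point set set \<Rightarrow> point list \<Rightarrow> bool" where
  "leftmost_vertices P as \<longleftrightarrow> set as \<subseteq> vertices P \<and> sorted_wrt (\<lambda>a b. snd a < snd b) as \<and>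
     (\<forall>v \<in> vertices P. v \<in> set as \<or> (\<exists>a \<in> set as. snd v = snd a \<and> fst a < fst v))"

text \<open>List indices start at 0, so that the lowest left-most vertex is \<open>as ! 0\<close>.\<close>

definition ladder_polyomino :: "point set set \<Rightarrow> bool" where
  "ladder_polyomino P \<longleftrightarrow> polyomino P \<and> horizontally_convex P \<and>
     (\<exists>as. leftmost_vertices P as \<and>
        (\<forall>i. 1 \<le> i \<and> i < length as \<longrightarrow>
           (\<exists>b. cell b \<in> P \<and> as ! i = upper_left b (b + (1, 1)))))"

definition inner_interval :: "point set set \<Rightarrow> point \<Rightarrow> point \<Rightarrow> bool" where
  "inner_interval P a b \<longleftrightarrow> proper_interval a b \<and> a \<in> vertices P \<and> b \<in> vertices P \<and>
     (\<forall>c. cell c \<subseteq> {a..b} \<longrightarrow> cell c \<in> P)"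


section \<open>Polynomial rings\<close>

text \<open>
  A monomial is its exponent vector, so the product of monomials is the sum of exponent vectors.
  \<open>poly_ring V\<close> is the ring of polynomials with variables in \<open>V\<close> only.
\<close>

type_synonym 'x monomial = "'x \<Rightarrow>\<^sub>0 nat"
type_synonym ('x, 'k) mpoly = "('x \<Rightarrow>\<^sub>0 nat) \<Rightarrow>\<^sub>0 'k"

definition monomials :: "'x set \<Rightarrow> 'x monomial set" where
  "monomials V = {m. Poly_Mapping.keys m \<subseteq> V}"

definition poly_ring :: "'x set \<Rightarrow> ('x, 'k :: field) mpoly ring" where
  "poly_ring V = \<lparr>carrier = {p. Poly_Mapping.keys p \<subseteq> monomials V},
     mult = (*), one = 1, zero = 0, add = (+)\<rparr>"

definition var :: "'x \<Rightarrow> ('x, 'k :: field) mpoly" where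
  "var x = Poly_Mapping.single (Poly_Mapping.single x 1) 1"

lemma cring_poly_ring: "cring (poly_ring V :: ('x, 'k :: field) mpoly ring)"
proof (intro cringI abelian_groupI comm_monoidI)
  fix p q :: "('x, 'k) mpoly"
  assume pq: "p \<in> carrier (poly_ring V)" "q \<in> carrier (poly_ring V)"
  show "p \<oplus>\<^bsub>poly_ring V\<^esub> q \<in> carrier (poly_ring V)"
    using pq Poly_Mapping.keys_add[of p q] by (auto simp: poly_ring_def)
  show "p \<otimes>\<^bsub>poly_ring V\<^esub> q \<in> carrier (poly_ring V)"
  proof -
    have "a + b \<in> monomials V" if "a \<in> monomials V" "b \<in> monomials V" for a b
      using that Poly_Mapping.keys_add[of a b] by (auto simp: monomials_def)
    then show ?thesis
      using pq Poly_Mapping.keys_mult[of p q] by (force simp: poly_ring_def)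
  qed
next
  fix p :: "('x, 'k) mpoly"
  assume "p \<in> carrier (poly_ring V)"
  then show "\<exists>q \<in> carrier (poly_ring V). q \<oplus>\<^bsub>poly_ring V\<^esub> p = \<zero>\<^bsub>poly_ring V\<^esub>"
    by (intro bexI[of _ "- p"]) (auto simp: poly_ring_def)
qed (auto simp: poly_ring_def monomials_def algebra_simps)

text \<open>A monomial order on the monomials in \<open>V\<close>; \<open>(u, v) \<in> r\<close> reads \<open>u \<le> v\<close>.\<close>

definition monomial_order :: "'x set \<Rightarrow> 'x monomial rel \<Rightarrow> bool" where
  "monomial_order V r \<longleftrightarrow> linear_order_on (monomials V) r \<and>
     (\<forall>u \<in> monomials V. (0, u) \<in> r) \<and>
     (\<forall>u v. \<forall>w \<in> monomials V. (u, v) \<in> r \<longrightarrow> (u + w, v + w) \<in> r)"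

text \<open>The initial monomial is taken without its coefficient, and is meaningful for \<open>p \<noteq> 0\<close> only.\<close>

definition initial_monomial :: "'x monomial rel \<Rightarrow> ('x, 'k :: field) mpoly \<Rightarrow> 'x monomial" where
  "initial_monomial r p =
     (THE u. u \<in> Poly_Mapping.keys p \<and> (\<forall>v \<in> Poly_Mapping.keys p. (v, u) \<in> r))"

definition squarefree_monomial :: "'x monomial \<Rightarrow> bool" where
  "squarefree_monomial u \<longleftrightarrow> (\<forall>x. Poly_Mapping.lookup u x \<le> 1)"


section \<open>Knutson ideals\<close>

definition colon_ideal :: "('a, 'm) ring_scheme \<Rightarrow> 'a set \<Rightarrow> 'a set \<Rightarrow> 'a set" where
  "colon_ideal R I J = {x \<in> carrier R. \<forall>y \<in> J. x \<otimes>\<^bsub>R\<^esub> y \<in> I}"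

inductive_set knutson_class :: "('a, 'm) ring_scheme \<Rightarrow> 'a \<Rightarrow> 'a set set"
  for R and f where
  principal: "PIdl\<^bsub>R\<^esub> f \<in> knutson_class R f"
| colon: "I \<in> knutson_class R f \<Longrightarrow> ideal J R \<Longrightarrow> colon_ideal R I J \<in> knutson_class R f"
| sum: "I \<in> knutson_class R f \<Longrightarrow> J \<in> knutson_class R f \<Longrightarrow> I <+>\<^bsub>R\<^esub> J \<in> knutson_class R f"
| inter: "I \<in> knutson_class R f \<Longrightarrow> J \<in> knutson_class R f \<Longrightarrow> I \<inter> J \<in> knutson_class R f"

definition knutson_ideal :: "'x set \<Rightarrow> ('x, 'k :: field) mpoly set \<Rightarrow> bool" where
  "knutson_ideal V I \<longleftrightarrow>
     (\<exists>f r. f \<in> carrier (poly_ring V) \<and> f \<noteq> 0 \<and> monomial_order V r \<and>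
        squarefree_monomial (initial_monomial r f) \<and> I \<in> knutson_class (poly_ring V) f)"


section \<open>Polyomino ideals\<close>

definition polyomino_ideal :: "point set set \<Rightarrow> (point, 'k :: field) mpoly set" where
  "polyomino_ideal P = Idl\<^bsub>poly_ring (vertices P)\<^esub>
     {var a * var b - var (upper_left a b) * var (lower_right a b) | a b. inner_interval P a b}"

end

theory Submission
  imports Defs "HOL-Library.Nat_Bijection"
begin

text \<open>
  Joining the anti-diagonal vertices of every cell partitions the vertices of a ladder polyomino
  into chains. To each chain belongs a Hessenberg determinant whose lexicographic initial monomial
  is the product of the variables of the chain, and \<open>f\<close> is the product of these determinants. Since the left boundary moves to the right upwards, all cells to the lower left of a
  chain belong to the polyomino. Modulo the \<open>2\<close>-minors of those cells and up to monomial factors,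
  the determinant is the product of the \<open>2\<close>-minors of the cells on the chain, so that dividing by
  all but one of them puts each single one into the Knutson class. By induction along the
  antidiagonals one obtains, up to saturation by the variables, the ideal generated by the
  \<open>2\<close>-minors of all cells. This saturation is the kernel of a map to a Laurent polynomial ring,
  and a straightening argument identifies it with the polyomino ideal.
\<close>

abbreviation (input) monom :: "'a \<Rightarrow> 'b::zero \<Rightarrow> 'a \<Rightarrow>\<^sub>0 'b" where
  "monom \<equiv> Poly_Mapping.single"

section \<open>Homomorphisms induced by maps of monomials\<close>

lemma poly_mapping_sum_monom:
  "p = (\<Sum>k\<in>Poly_Mapping.keys p. monom k (Poly_Mapping.lookup p k))"
proof (rule poly_mapping_eqI)
  fix k
  have "(\<Sum>j\<in>Poly_Mapping.keys p. Poly_Mapping.lookup (monom j (Poly_Mapping.lookup p j)) k)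
      = (\<Sum>j\<in>Poly_Mapping.keys p. if j = k then Poly_Mapping.lookup p j else 0)"
    by (rule sum.cong) (auto simp: lookup_single)
  then show "Poly_Mapping.lookup p k
      = Poly_Mapping.lookup (\<Sum>j\<in>Poly_Mapping.keys p. monom j (Poly_Mapping.lookup p j)) k"
    by (simp add: lookup_sum sum.delta in_keys_iff)
qed

definition push :: "('a \<Rightarrow> 'b) \<Rightarrow> ('a \<Rightarrow>\<^sub>0 'k::comm_monoid_add) \<Rightarrow> 'b \<Rightarrow>\<^sub>0 'k" where
  "push g p = (\<Sum>m\<in>Poly_Mapping.keys p. monom (g m) (Poly_Mapping.lookup p m))"

lemma push_0 [simp]: "push g 0 = 0"
  by (simp add: push_def)

lemma push_monom [simp]: "push g (monom m c) = monom (g m) c"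
  by (simp add: push_def)

lemma push_one: "g 0 = 0 \<Longrightarrow> push g 1 = 1"
  using push_monom[of g 0 1] by (metis single_one)

lemma push_add: "push g (p + q) = push g p + push g q"
  unfolding push_def by (rule setsum_keys_plus_distrib) (auto simp: single_add)

lemma push_uminus:
  fixes p :: "'a \<Rightarrow>\<^sub>0 'k::ab_group_add"
  shows "push g (- p) = - push g p"
  using push_add[of g p "- p"] by (simp add: eq_neg_iff_add_eq_0 add.commute)

lemma push_diff:
  fixes p :: "'a \<Rightarrow>\<^sub>0 'k::ab_group_add"
  shows "push g (p - q) = push g p - push g q"
  using push_add[of g p "- q"] by (simp add: push_uminus)

lemma push_sum: "push g (sum f A) = (\<Sum>i\<in>A. push g (f i))"
  by (induction A rule: infinite_finite_induct) (auto simp: push_add)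

lemma push_push: "push h (push g p) = push (h \<circ> g) p"
  by (simp add: push_sum push_def[of g] push_def[of "h \<circ> g"])

lemma push_mult:
  fixes p q :: "'a::monoid_add \<Rightarrow>\<^sub>0 'k::semiring_0"
  assumes g: "\<And>a b. g (a + b) = g a + g b"
  shows "push g (p * q) = push g p * push g q"
proof -
  have "p * q = (\<Sum>k\<in>Poly_Mapping.keys p. monom k (Poly_Mapping.lookup p k)) *
      (\<Sum>l\<in>Poly_Mapping.keys q. monom l (Poly_Mapping.lookup q l))"
    by (simp flip: poly_mapping_sum_monom)
  also have "\<dots> = (\<Sum>k\<in>Poly_Mapping.keys p. \<Sum>l\<in>Poly_Mapping.keys q.
      monom (k + l) (Poly_Mapping.lookup p k * Poly_Mapping.lookup q l))"
    by (simp add: sum_product mult_single)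
  finally show ?thesis
    by (simp add: push_sum g) (simp add: push_def sum_product mult_single)
qed

lemma push_inj_eq_0:
  assumes "inj g" "push g p = 0"
  shows "p = 0"
proof -
  have "push (inv_into UNIV g) (push g p) = p"
    unfolding push_push using \<open>inj g\<close> by (simp add: push_def poly_mapping_sum_monom[symmetric])
  then show ?thesis
    using assms by simp
qed

lemma push_eq_0_binomials:
  fixes p :: "'a \<Rightarrow>\<^sub>0 'k::ab_group_add"
  assumes "push g p = 0"
  shows "\<exists>\<rho>. (\<forall>m\<in>Poly_Mapping.keys p. \<rho> m \<in> Poly_Mapping.keys p \<and> g (\<rho> m) = g m) \<and>
    p = (\<Sum>m\<in>Poly_Mapping.keys p. monom m (Poly_Mapping.lookup p m) - monom (\<rho> m) (Poly_Mapping.lookup p m))"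
proof -
  define \<tau> where "\<tau> c = (SOME m. m \<in> Poly_Mapping.keys p \<and> g m = c)" for c
  have \<tau>: "\<tau> (g m) \<in> Poly_Mapping.keys p \<and> g (\<tau> (g m)) = g m" if "m \<in> Poly_Mapping.keys p" for m
    unfolding \<tau>_def
    using someI[of "\<lambda>m'. m' \<in> Poly_Mapping.keys p \<and> g m' = g m" m] that by blast
  have "push (\<tau> \<circ> g) p = 0"
    using assms by (simp flip: push_push)
  then have "p = (\<Sum>m\<in>Poly_Mapping.keys p.
      monom m (Poly_Mapping.lookup p m) - monom ((\<tau> \<circ> g) m) (Poly_Mapping.lookup p m))"
    by (simp add: sum_subtractf push_def flip: poly_mapping_sum_monom)
  then show ?thesis
    using \<tau> by (intro exI[of _ "\<tau> \<circ> g"]) auto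
qed

definition monomial_map :: "('x \<Rightarrow> 'y \<Rightarrow>\<^sub>0 int) \<Rightarrow> 'x monomial \<Rightarrow> 'y \<Rightarrow>\<^sub>0 int" where
  "monomial_map e m = (\<Sum>v\<in>Poly_Mapping.keys m. frag_cmul (int (Poly_Mapping.lookup m v)) (e v))"

lemma monomial_map_0 [simp]: "monomial_map e 0 = 0"
  by (simp add: monomial_map_def)

lemma monomial_map_add: "monomial_map e (m + n) = monomial_map e m + monomial_map e n"
  unfolding monomial_map_def
  by (rule setsum_keys_plus_distrib) (auto simp: frag_cmul_distrib)

lemma monomial_map_single [simp]: "monomial_map e (monom v (Suc 0)) = e v"
  by (simp add: monomial_map_def)

lemma frag_extend_monomial_map:
  "frag_extend h (monomial_map e m) = monomial_map (\<lambda>v. frag_extend h (e v)) m"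
  by (simp add: monomial_map_def frag_extend_sum frag_extend_cmul)

lemma lookup_monomial_map:
  "Poly_Mapping.lookup (monomial_map e m) k =
     (\<Sum>v\<in>Poly_Mapping.keys m. int (Poly_Mapping.lookup m v) * Poly_Mapping.lookup (e v) k)"
  by (simp add: monomial_map_def lookup_sum)

section \<open>Evaluation of polynomials at Laurent monomials\<close>

text \<open>
  The exponents are indexed by natural numbers because their linear order makes the target ring an
  instance of \<^class>\<open>idom\<close>.
\<close>

definition laurent :: "('x \<Rightarrow> nat \<Rightarrow>\<^sub>0 int) \<Rightarrow> ('x, 'k::field) mpoly \<Rightarrow> (nat \<Rightarrow>\<^sub>0 int) \<Rightarrow>\<^sub>0 'k" where
  "laurent e = push (monomial_map e)"

lemma laurent_simps [simp]:
  "laurent e 0 = 0"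
  "laurent e (p + q) = laurent e p + laurent e q"
  "laurent e (p - q) = laurent e p - laurent e q"
  "laurent e (p * q) = laurent e p * laurent e q"
  "laurent e 1 = 1"
  "laurent e (var v) = monom (e v) 1"
proof -
  show "laurent e 1 = 1"
    by (simp add: laurent_def push_one)
qed (simp_all add: laurent_def push_add push_diff push_mult monomial_map_add var_def)

lemma laurent_var_neq_0 [simp]: "laurent e (var v :: ('x, 'k::field) mpoly) \<noteq> 0"
  by (metis laurent_simps(6) lookup_single_eq lookup_zero zero_neq_one)

lemma laurent_prod: "laurent e (prod f A) = (\<Prod>i\<in>A. laurent e (f i))"
  by (induction A rule: infinite_finite_induct) auto

lemma laurent_power: "laurent e (p ^ n) = laurent e p ^ n"
  by (induction n) auto

lemma laurent_factor:
  assumes "laurent e p = 0" "\<And>v. e' v = frag_extend h (e v)"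
  shows "laurent e' p = 0"
proof -
  have "monomial_map e' = frag_extend h \<circ> monomial_map e"
    using assms(2) by (simp add: fun_eq_iff frag_extend_monomial_map flip: assms(2))
  then show ?thesis
    using assms(1) by (simp add: laurent_def flip: push_push)
qed

text \<open>
  On the torus, the vanishing of the binomial of a cell expresses the variable at its upper right
  vertex by the others. Eliminating these variables for the cells with lower left vertex in \<open>Q\<close>
  leaves the following Laurent monomials.
\<close>

fun torus_exponent :: "point set \<Rightarrow> nat \<Rightarrow> nat \<Rightarrow> nat \<Rightarrow>\<^sub>0 int" where
  "torus_exponent Q (Suc x) (Suc y) =
     (if (x, y) \<in> Q then torus_exponent Q x (Suc y) + torus_exponent Q (Suc x) y - torus_exponent Q x y
      else frag_of (prod_encode (Suc x, Suc y)))"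
| "torus_exponent Q x y = frag_of (prod_encode (x, y))"

definition torus :: "point set \<Rightarrow> (point, 'k::field) mpoly \<Rightarrow> (nat \<Rightarrow>\<^sub>0 int) \<Rightarrow>\<^sub>0 'k" where
  "torus Q = laurent (\<lambda>v. torus_exponent Q (fst v) (snd v))"

definition cell_binomial :: "nat \<Rightarrow> nat \<Rightarrow> (point, 'k::field) mpoly" where
  "cell_binomial x y = var (x, Suc y) * var (Suc x, y) - var (x, y) * var (Suc x, Suc y)"

lemma torus_factor:
  assumes "torus Q p = 0"
    and "\<And>x y. (x, y) \<in> Q \<Longrightarrow> e (Suc x, Suc y) = e (x, Suc y) + e (Suc x, y) - e (x, y)"
  shows "laurent e p = 0"
proof -
  have "frag_extend (\<lambda>k. e (prod_decode k)) (torus_exponent Q x y) = e (x, y)" for x y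
  proof (induction "x + y" arbitrary: x y rule: less_induct)
    case less
    show ?case
    proof (cases "(x, y) \<in> (\<lambda>(x, y). (Suc x, Suc y)) ` Q")
      case True
      then obtain x' y' where "x = Suc x'" "y = Suc y'" "(x', y') \<in> Q"
        by auto
      then show ?thesis
        using less by (simp add: frag_extend_add frag_extend_diff assms(2))
    next
      case False
      then have "torus_exponent Q x y = frag_of (prod_encode (x, y))"
        by (cases x; cases y) auto
      then show ?thesis
        by simp
    qed
  qed
  then show ?thesis
    using laurent_factor[OF assms(1)[unfolded torus_def], of e "\<lambda>k. e (prod_decode k)"] by simp
qed


lemma torus_mono:
  assumes "torus Q p = 0" "Q \<subseteq> Q'"
  shows "torus Q' p = 0"
  unfolding torus_def
  by (rule torus_factor[OF assms(1)]) (use assms(2) in auto)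

lemma torus_cell_binomial_mem:
  assumes "(x, y) \<in> Q"
  shows "torus Q (cell_binomial x y) = 0"
  using assms by (simp add: torus_def cell_binomial_def mult_single add.commute)

lemma keys_torus_exponent: "k \<in> Poly_Mapping.keys (torus_exponent Q x y) \<Longrightarrow>
    \<exists>a b. k = prod_encode (a, b) \<and> a \<le> x \<and> b \<le> y"
proof (induction Q x y arbitrary: k rule: torus_exponent.induct)
  case (1 Q x y)
  have "Poly_Mapping.keys (torus_exponent Q (Suc x) (Suc y)) \<subseteq> Poly_Mapping.keys (torus_exponent Q x (Suc y)) \<union>
      Poly_Mapping.keys (torus_exponent Q (Suc x) y) \<union> Poly_Mapping.keys (torus_exponent Q x y)" if "(x, y) \<in> Q"
    using that keys_diff[of "torus_exponent Q x (Suc y) + torus_exponent Q (Suc x) y" "torus_exponent Q x y"]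
      Poly_Mapping.keys_add[of "torus_exponent Q x (Suc y)" "torus_exponent Q (Suc x) y"] by auto
  then consider "k \<in> Poly_Mapping.keys (torus_exponent Q x (Suc y))" "(x, y) \<in> Q"
    | "k \<in> Poly_Mapping.keys (torus_exponent Q (Suc x) y)" "(x, y) \<in> Q"
    | "k \<in> Poly_Mapping.keys (torus_exponent Q x y)" "(x, y) \<in> Q"
    | "k = prod_encode (Suc x, Suc y)"
    using 1(4) by (cases "(x, y) \<in> Q") auto
  then show ?case
  proof cases
    case 1
    then show ?thesis using "1.IH"(1) le_SucI by blast
  next
    case 2
    then show ?thesis using "1.IH"(2) le_SucI by blast
  next
    case 3
    then show ?thesis using "1.IH"(3) le_SucI by blast
  qed blast
qed auto

lemma lookup_torus_exponent_eq_0: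
  assumes "x < a \<or> y < b"
  shows "Poly_Mapping.lookup (torus_exponent Q x y) (prod_encode (a, b)) = 0"
proof (rule ccontr)
  assume "\<not> ?thesis"
  then have "prod_encode (a, b) \<in> Poly_Mapping.keys (torus_exponent Q x y)"
    by (simp add: in_keys_iff)
  from keys_torus_exponent[OF this] show False
    using assms by auto
qed

lemma torus_cell_binomial_not_mem:
  assumes "(x, y) \<notin> Q"
  shows "torus Q (cell_binomial x y :: (point, 'k::field) mpoly) \<noteq> 0"
proof
  assume "torus Q (cell_binomial x y :: (point, 'k) mpoly) = 0"
  then have *: "monom (torus_exponent Q x (Suc y) + torus_exponent Q (Suc x) y) (1 :: 'k) =
      monom (torus_exponent Q x y + torus_exponent Q (Suc x) (Suc y)) 1"
    by (simp add: torus_def cell_binomial_def mult_single del: torus_exponent.simps)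
  have "torus_exponent Q x (Suc y) + torus_exponent Q (Suc x) y = torus_exponent Q x y + torus_exponent Q (Suc x) (Suc y)"
    by (rule ccontr) (metis * lookup_single_eq lookup_single_not_eq zero_neq_one)
  then have "Poly_Mapping.lookup (torus_exponent Q x (Suc y) + torus_exponent Q (Suc x) y) (prod_encode (Suc x, Suc y)) =
      Poly_Mapping.lookup (torus_exponent Q x y + torus_exponent Q (Suc x) (Suc y)) (prod_encode (Suc x, Suc y))"
    by simp
  then have "Poly_Mapping.lookup (torus_exponent Q (Suc x) (Suc y)) (prod_encode (Suc x, Suc y)) = 0"
    by (simp add: lookup_add lookup_torus_exponent_eq_0 del: torus_exponent.simps)
  then show False
    using assms by simp
qed

lemma torus_empty_eq_0:
  assumes "torus {} p = 0"
  shows "p = 0"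
proof (rule push_inj_eq_0)
  let ?e = "\<lambda>v. torus_exponent {} (fst v) (snd v)"
  show "push (monomial_map ?e) p = 0"
    using assms by (simp add: torus_def laurent_def)
  have e: "?e v = frag_of (prod_encode v)" for v
    by (cases v; cases "fst v"; cases "snd v") auto
  have "Poly_Mapping.lookup (monomial_map ?e m) (prod_encode v) = int (Poly_Mapping.lookup m v)" for m v
  proof -
    have "Poly_Mapping.lookup (monomial_map ?e m) (prod_encode v) =
        (\<Sum>w\<in>Poly_Mapping.keys m. if w = v then int (Poly_Mapping.lookup m w) else 0)"
      unfolding lookup_monomial_map e by (rule sum.cong) auto
    then show ?thesis
      by (simp add: sum.delta in_keys_iff)
  qed
  then show "inj (monomial_map ?e)"
    by (intro injI poly_mapping_eqI) (metis of_nat_eq_iff)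
qed

lemma mpoly_mult_eq_0:
  fixes p q :: "(point, 'k::field) mpoly"
  shows "p * q = 0 \<longleftrightarrow> p = 0 \<or> q = 0"
proof
  assume "p * q = 0"
  then have "torus {} p * torus {} q = 0"
    by (metis laurent_simps(1,4) torus_def)
  then show "p = 0 \<or> q = 0"
    by (auto dest: torus_empty_eq_0)
qed auto

section \<open>Ideals of the polynomial ring\<close>

lemma poly_ring_simps [simp]:
  "mult (poly_ring V) = (*)" "one (poly_ring V) = 1" "zero (poly_ring V) = 0" "add (poly_ring V) = (+)"
  by (simp_all add: poly_ring_def)

lemma poly_carrier_iff: "p \<in> carrier (poly_ring V) \<longleftrightarrow> (\<forall>m\<in>Poly_Mapping.keys p. Poly_Mapping.keys m \<subseteq> V)"
  by (auto simp: poly_ring_def monomials_def)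

lemma poly_carrier_0 [simp]: "0 \<in> carrier (poly_ring V)"
  and poly_carrier_1 [simp]: "1 \<in> carrier (poly_ring V)"
  by (simp_all add: poly_carrier_iff)

lemma poly_carrier_add [simp]:
  "p \<in> carrier (poly_ring V) \<Longrightarrow> q \<in> carrier (poly_ring V) \<Longrightarrow> p + q \<in> carrier (poly_ring V)"
  using cring.cring_simprules(1)[OF cring_poly_ring] by fastforce

lemma poly_carrier_mult [simp]:
  "p \<in> carrier (poly_ring V) \<Longrightarrow> q \<in> carrier (poly_ring V) \<Longrightarrow> p * q \<in> carrier (poly_ring V)"
  using cring.cring_simprules(5)[OF cring_poly_ring] by fastforce

lemma poly_carrier_uminus [simp]: "p \<in> carrier (poly_ring V) \<Longrightarrow> - p \<in> carrier (poly_ring V)"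
  by (auto simp: poly_carrier_iff)

lemma poly_carrier_diff [simp]:
  "p \<in> carrier (poly_ring V) \<Longrightarrow> q \<in> carrier (poly_ring V) \<Longrightarrow> p - q \<in> carrier (poly_ring V)"
  using poly_carrier_add[of p V "- q"] by simp

lemma poly_carrier_power [simp]: "p \<in> carrier (poly_ring V) \<Longrightarrow> p ^ n \<in> carrier (poly_ring V)"
  by (induction n) auto

lemma poly_carrier_prod [simp]:
  "(\<And>i. i \<in> A \<Longrightarrow> g i \<in> carrier (poly_ring V)) \<Longrightarrow> prod g A \<in> carrier (poly_ring V)"
  by (induction A rule: infinite_finite_induct) auto

lemma poly_carrier_var [simp]: "v \<in> V \<Longrightarrow> var v \<in> carrier (poly_ring V)"
  by (simp add: poly_carrier_iff var_def)

lemma poly_ideal_iff: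
  "ideal I (poly_ring V :: ('x, 'k::field) mpoly ring) \<longleftrightarrow> I \<subseteq> carrier (poly_ring V) \<and> 0 \<in> I \<and>
     (\<forall>p\<in>I. \<forall>q\<in>I. p + q \<in> I) \<and> (\<forall>r\<in>carrier (poly_ring V). \<forall>p\<in>I. r * p \<in> I)"
    (is "?l \<longleftrightarrow> ?r")
proof
  assume ?l
  then have "additive_subgroup I (poly_ring V)"
    by (rule ideal.axioms)
  from additive_subgroup.a_subset[OF this] additive_subgroup.zero_closed[OF this]
    additive_subgroup.a_closed[OF this] ideal.I_l_closed[OF \<open>?l\<close>]
  show ?r
    unfolding poly_ring_simps by blast
next
  assume r: ?r
  have ring: "ring (poly_ring V :: ('x, 'k) mpoly ring)"
    by (rule cring.axioms(1)[OF cring_poly_ring])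
  have inv: "inv\<^bsub>add_monoid (poly_ring V)\<^esub> p = - p" if "p \<in> carrier (poly_ring V)" for p :: "('x, 'k) mpoly"
    using that abelian_group.minus_equality[OF ring.is_abelian_group[OF ring], of "- p" p]
    by (simp add: a_inv_def)
  have neg: "- p \<in> I" if "p \<in> I" for p
  proof -
    have "- 1 * p \<in> I"
      using r that poly_carrier_uminus[OF poly_carrier_1, of V] by blast
    then show ?thesis
      by simp
  qed
  show ?l
  proof (rule idealI)
    show "subgroup I (add_monoid (poly_ring V))"
    proof (rule subgroup.intro)
      show "inv\<^bsub>add_monoid (poly_ring V)\<^esub> p \<in> I" if "p \<in> I" for p
        using inv[of p] neg[OF that] r that by (metis subsetD)
    qed (use r in auto)
    show "p \<otimes>\<^bsub>poly_ring V\<^esub> q \<in> I" if "p \<in> I" "q \<in> carrier (poly_ring V)" for p q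
      using r that by (simp add: mult.commute[of p q])
  qed (use r ring in auto)
qed

lemma
  assumes "ideal I (poly_ring V :: ('x, 'k::field) mpoly ring)"
  shows poly_ideal_subset: "I \<subseteq> carrier (poly_ring V)"
    and poly_ideal_0: "0 \<in> I"
    and poly_ideal_add: "p \<in> I \<Longrightarrow> q \<in> I \<Longrightarrow> p + q \<in> I"
    and poly_ideal_mult: "r \<in> carrier (poly_ring V) \<Longrightarrow> p \<in> I \<Longrightarrow> r * p \<in> I"
    and poly_ideal_diff: "p \<in> I \<Longrightarrow> q \<in> I \<Longrightarrow> p - q \<in> I"
proof -
  note I = assms[unfolded poly_ideal_iff]
  show "I \<subseteq> carrier (poly_ring V)" "0 \<in> I" "p \<in> I \<Longrightarrow> q \<in> I \<Longrightarrow> p + q \<in> I"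
    "r \<in> carrier (poly_ring V) \<Longrightarrow> p \<in> I \<Longrightarrow> r * p \<in> I"
    using I by auto
  assume "p \<in> I" "q \<in> I"
  moreover from this have "- 1 * q \<in> I"
    using I poly_carrier_uminus[OF poly_carrier_1, of V] by blast
  ultimately have "p + - 1 * q \<in> I"
    using I by blast
  then show "p - q \<in> I"
    by simp
qed

lemma poly_ideal_sum:
  assumes "ideal I (poly_ring V :: ('x, 'k::field) mpoly ring)" "\<And>i. i \<in> A \<Longrightarrow> g i \<in> I"
  shows "sum g A \<in> I"
  using assms(2) by (induction A rule: infinite_finite_induct)
    (auto simp: poly_ideal_0[OF assms(1)] poly_ideal_add[OF assms(1)])

lemma poly_PIdl: "PIdl\<^bsub>poly_ring V\<^esub> q = {r * q | r. r \<in> carrier (poly_ring V)}"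
  by (simp add: cgenideal_def)

lemma knutson_class_ideal:
  fixes f :: "('x, 'k::field) mpoly"
  assumes "I \<in> knutson_class (poly_ring V) f" "f \<in> carrier (poly_ring V)"
  shows "ideal I (poly_ring V)"
  using assms
proof (induction rule: knutson_class.induct)
  case principal
  then show ?case
    by (simp add: cring.cgenideal_ideal cring_poly_ring)
next
  case (colon I J)
  then show ?case
    unfolding poly_ideal_iff colon_ideal_def by (auto simp: algebra_simps subset_iff)
next
  case (sum I J)
  then show ?case
    by (simp add: cring.axioms(1) cring_poly_ring ring.add_ideals)
next
  case (inter I J)
  then show ?case
    by (simp add: poly_ideal_iff subset_iff)
qed

lemma knutson_class_colon:
  fixes f :: "('x, 'k::field) mpoly"
  assumes "I \<in> knutson_class (poly_ring V) f" "f \<in> carrier (poly_ring V)" "q \<in> carrier (poly_ring V)"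
  shows "{p \<in> carrier (poly_ring V). p * q \<in> I} \<in> knutson_class (poly_ring V) f"
proof -
  have "(\<forall>y\<in>PIdl\<^bsub>poly_ring V\<^esub> q. p * y \<in> I) \<longleftrightarrow> p * q \<in> I" for p
  proof
    assume "\<forall>y\<in>PIdl\<^bsub>poly_ring V\<^esub> q. p * y \<in> I"
    moreover have "q \<in> PIdl\<^bsub>poly_ring V\<^esub> q"
      unfolding poly_PIdl by (auto intro!: exI[of _ 1])
    ultimately show "p * q \<in> I"
      by blast
  next
    assume "p * q \<in> I"
    then show "\<forall>y\<in>PIdl\<^bsub>poly_ring V\<^esub> q. p * y \<in> I"
      using poly_ideal_mult[OF knutson_class_ideal[OF assms(1,2)], of _ "p * q"]
      by (auto simp: poly_PIdl algebra_simps)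
  qed
  then have "{p \<in> carrier (poly_ring V). p * q \<in> I} = colon_ideal (poly_ring V) I (PIdl\<^bsub>poly_ring V\<^esub> q)"
    by (simp add: colon_ideal_def)
  then show ?thesis
    using assms by (simp add: knutson_class.colon cring.cgenideal_ideal cring_poly_ring)
qed

lemma knutson_class_factor:
  fixes f :: "(point, 'k::field) mpoly"
  assumes "f = d * g" "f \<noteq> 0" and dg: "d \<in> carrier (poly_ring V)" "g \<in> carrier (poly_ring V)"
  shows "PIdl\<^bsub>poly_ring V\<^esub> d \<in> knutson_class (poly_ring V) f"
proof -
  have "p * g \<in> PIdl\<^bsub>poly_ring V\<^esub> f \<longleftrightarrow> p \<in> PIdl\<^bsub>poly_ring V\<^esub> d" if "p \<in> carrier (poly_ring V)" for p
  proof -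
    have "p * g = r * f \<longleftrightarrow> p = r * d" for r
    proof -
      have "p * g = r * f \<longleftrightarrow> (p - r * d) * g = 0"
        by (simp add: assms(1) algebra_simps)
      also have "\<dots> \<longleftrightarrow> p = r * d"
        using assms(1,2) by (simp add: mpoly_mult_eq_0)
      finally show ?thesis .
    qed
    then show ?thesis
      by (simp add: poly_PIdl)
  qed
  moreover have "PIdl\<^bsub>poly_ring V\<^esub> d \<subseteq> carrier (poly_ring V)"
    using dg by (auto simp: poly_PIdl)
  ultimately have "{p \<in> carrier (poly_ring V). p * g \<in> PIdl\<^bsub>poly_ring V\<^esub> f} = PIdl\<^bsub>poly_ring V\<^esub> d"
    by blast
  then show ?thesis
    using knutson_class_colon[OF knutson_class.principal, of f V g] assms by simp
qed

lemma poly_set_add: "I <+>\<^bsub>poly_ring V\<^esub> J = {p + q | p q. p \<in> I \<and> q \<in> J}"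
  by (auto simp: set_add_def')

text \<open>The zero ideal is the neutral element for sums, but it does not belong to \<open>knutson_class\<close>.\<close>

definition knutson_class0 :: "'x set \<Rightarrow> ('x, 'k::field) mpoly \<Rightarrow> ('x, 'k) mpoly set set" where
  "knutson_class0 V f = insert {0} (knutson_class (poly_ring V) f)"

lemma knutson_class0_ideal:
  "I \<in> knutson_class0 V f \<Longrightarrow> f \<in> carrier (poly_ring V) \<Longrightarrow> ideal I (poly_ring V)"
  using knutson_class_ideal[of I V f] by (auto simp: knutson_class0_def poly_ideal_iff)

lemma knutson_class0_sum:
  assumes "I \<in> knutson_class0 V f" "J \<in> knutson_class (poly_ring V) f"
  shows "{p + q | p q. p \<in> I \<and> q \<in> J} \<in> knutson_class (poly_ring V) f"
  using assms knutson_class.sum[of I "poly_ring V" f J]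
  by (auto simp: knutson_class0_def poly_set_add)

definition saturation :: "'x set \<Rightarrow> ('x, 'k::field) mpoly set \<Rightarrow> ('x, 'k) mpoly set" where
  "saturation V I = {p \<in> carrier (poly_ring V). \<exists>N. (\<Prod>v\<in>V. var v) ^ N * p \<in> I}"

lemma saturation_mono: "I \<subseteq> J \<Longrightarrow> saturation V I \<subseteq> saturation V J"
  by (auto simp: saturation_def)

lemma saturation_superset: "I \<subseteq> carrier (poly_ring V) \<Longrightarrow> I \<subseteq> saturation V I"
  unfolding saturation_def by (auto intro!: exI[of _ 0])

lemma saturation_witness_mono:
  assumes "ideal I (poly_ring V)" "(\<Prod>v\<in>V. var v) ^ N * p \<in> I" "N \<le> N'"
  shows "(\<Prod>v\<in>V. var v) ^ N' * p \<in> I"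
proof -
  have "(\<Prod>v\<in>V. var v) ^ N' * p = (\<Prod>v\<in>V. var v) ^ (N' - N) * ((\<Prod>v\<in>V. var v) ^ N * p)"
    using assms(3) by (simp add: mult.assoc[symmetric] flip: power_add)
  then show ?thesis
    using poly_ideal_mult[OF assms(1) _ assms(2)] by simp
qed

lemma saturation_common_witness:
  assumes "ideal I (poly_ring V)" "finite G" "G \<subseteq> saturation V I"
  shows "\<exists>N. \<forall>p\<in>G. (\<Prod>v\<in>V. var v) ^ N * p \<in> I"
  using assms(2,3)
proof (induction G rule: finite_induct)
  case (insert p G)
  then obtain N where N: "\<forall>p\<in>G. (\<Prod>v\<in>V. var v) ^ N * p \<in> I"
    by auto
  obtain M where M: "(\<Prod>v\<in>V. var v) ^ M * p \<in> I"
    using insert.prems by (auto simp: saturation_def)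
  have "\<forall>q\<in>insert p G. (\<Prod>v\<in>V. var v) ^ (N + M) * q \<in> I"
    using N M saturation_witness_mono[OF assms(1)] by (metis insert_iff le_add1 le_add2)
  then show ?case
    by blast
qed auto

lemma saturation_ideal:
  assumes I: "ideal I (poly_ring V :: ('x, 'k::field) mpoly ring)"
  shows "ideal (saturation V I) (poly_ring V)"
  unfolding poly_ideal_iff
proof (intro conjI ballI)
  show "saturation V I \<subseteq> carrier (poly_ring V)"
    by (auto simp: saturation_def)
  show "0 \<in> saturation V I"
    using poly_ideal_0[OF I] by (simp add: saturation_def)
next
  fix p q assume pq: "p \<in> saturation V I" "q \<in> saturation V I"
  then obtain N where "\<forall>r\<in>{p, q}. (\<Prod>v\<in>V. var v) ^ N * r \<in> I"
    using saturation_common_witness[OF I, of "{p, q}"] by auto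
  then have "(\<Prod>v\<in>V. var v) ^ N * (p + q) \<in> I"
    using poly_ideal_add[OF I] by (simp add: distrib_left)
  then show "p + q \<in> saturation V I"
    using pq by (auto simp: saturation_def)
next
  fix r p :: "('x, 'k) mpoly"
  assume rp: "r \<in> carrier (poly_ring V)" "p \<in> saturation V I"
  then obtain N where "(\<Prod>v\<in>V. var v) ^ N * p \<in> I"
    by (auto simp: saturation_def)
  then have "r * ((\<Prod>v\<in>V. var v) ^ N * p) \<in> I"
    by (rule poly_ideal_mult[OF I rp(1)])
  then show "r * p \<in> saturation V I"
    using rp by (auto simp: saturation_def algebra_simps)
qed

lemma saturation_cancel_var:
  assumes "ideal I (poly_ring V)" "finite V" "v \<in> V" "p \<in> carrier (poly_ring V)"
    and "var v * p \<in> saturation V I"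
  shows "p \<in> saturation V I"
proof -
  obtain N where N: "(\<Prod>v\<in>V. var v) ^ N * (var v * p) \<in> I"
    using assms(5) by (auto simp: saturation_def)
  have "(\<Prod>v\<in>V. var v) ^ Suc N * p = (\<Prod>v\<in>V - {v}. var v) * ((\<Prod>v\<in>V. var v) ^ N * (var v * p))"
    using assms(2,3) by (simp add: prod.remove[of V v] algebra_simps)
  also have "\<dots> \<in> I"
    by (intro poly_ideal_mult[OF assms(1) _ N] poly_carrier_prod poly_carrier_var) auto
  finally show ?thesis
    using assms(4) unfolding saturation_def by blast
qed

section \<open>Chains of cells\<close>

text \<open>
  Put \<open>v\<^sub>i = (a + i, b - i)\<close>. The value at \<open>y = b - n\<close> is the determinant with diagonal \<open>v\<^sub>0, \<dots>, v\<^sub>n\<close>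
  of the variables in columns \<open>a, \<dots>, a + n\<close> and rows \<open>b, \<dots>, b - n\<close>, with \<open>0\<close> in place of the
  entries beyond the first superdiagonal. For general \<open>y\<close> the last row is replaced by row \<open>y\<close>, which
  makes the expansion along the last column a recursion.
\<close>

primrec hessenberg :: "nat \<Rightarrow> nat \<Rightarrow> nat \<Rightarrow> nat \<Rightarrow> (point, 'k::field) mpoly" where
  "hessenberg a b 0 y = var (a, y)"
| "hessenberg a b (Suc n) y = var (a + Suc n, y) * hessenberg a b n (b - n) - var (a + Suc n, b - n) * hessenberg a b n y"

locale ladder_cells =
  fixes P :: "point set set"
  assumes finite_P: "finite P"
    and P_cells: "C \<in> P \<Longrightarrow> \<exists>a. C = cell a"
    and cell_pos: "cell (x, y) \<in> P \<Longrightarrow> 0 < x \<and> 0 < y"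
    and lower_left_cell: "(x, y) \<in> vertices P \<Longrightarrow> cell (x', q) \<in> P \<Longrightarrow> q < y \<Longrightarrow> x \<le> p \<Longrightarrow> p \<le> x'
      \<Longrightarrow> cell (p, q) \<in> P"
begin

abbreviation V :: "point set" where
  "V \<equiv> vertices P"

lemma cell_vertices:
  assumes "cell (x, y) \<in> P"
  shows "(x, y) \<in> V" "(Suc x, y) \<in> V" "(x, Suc y) \<in> V" "(Suc x, Suc y) \<in> V"
proof -
  have "cell (x, y) = {(x, y), (Suc x, y), (x, Suc y), (Suc x, Suc y)}"
    by (auto simp: cell_eq)
  then show "(x, y) \<in> V" "(Suc x, y) \<in> V" "(x, Suc y) \<in> V" "(Suc x, Suc y) \<in> V"
    using assms unfolding vertices_def by blast+
qed

lemma vertex_cases: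
  assumes "v \<in> V"
  obtains x y where "cell (x, y) \<in> P" "v \<in> {(x, y), (Suc x, y), (x, Suc y), (Suc x, Suc y)}"
proof -
  obtain C where C: "C \<in> P" "v \<in> C"
    using assms by (auto simp: vertices_def)
  then obtain a where "C = cell a"
    using P_cells by blast
  then show ?thesis
    using that[of "fst a" "snd a"] C by (cases a) (auto simp: cell_eq)
qed

lemma vertex_pos: "(x, y) \<in> V \<Longrightarrow> 0 < x \<and> 0 < y"
  by (auto elim!: vertex_cases dest: cell_pos)

lemma finite_V: "finite V"
  unfolding vertices_def
proof (rule finite_Union[OF finite_P])
  show "finite C" if "C \<in> P" for C
    using P_cells[OF that] by (auto simp: cell_eq)
qed

lemma cell_binomial_carrier: "cell (x, y) \<in> P \<Longrightarrow> cell_binomial x y \<in> carrier (poly_ring V)"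
  using cell_vertices[of x y] by (simp add: cell_binomial_def)

lemma strip_binomial:
  assumes I: "ideal I (poly_ring V :: (point, 'k::field) mpoly ring)"
    and "x \<le> x'"
    and cells: "\<And>p. x \<le> p \<Longrightarrow> p < x' \<Longrightarrow> cell (p, y) \<in> P \<and> cell_binomial p y \<in> saturation V I"
  shows "var (x, y) * var (x', Suc y) - var (x, Suc y) * var (x', y) \<in> saturation V I"
  using assms(2) cells
proof (induction x' rule: dec_induct)
  case base
  then show ?case
    using poly_ideal_0[OF saturation_ideal[OF I]] by (simp add: mult.commute)
next
  case (step x')
  note S = saturation_ideal[OF I]
  let ?b = "\<lambda>x'. var (x, y) * var (x', Suc y) - var (x, Suc y) * var (x', y)"
  have c: "cell (x', y) \<in> P" "cell_binomial x' y \<in> saturation V I" "cell (x, y) \<in> P"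
    using step.prems[of x'] step.prems[of x] step.hyps by auto
  note v = cell_vertices[OF c(1)] cell_vertices[OF c(3)]
  have "var (x', y) * ?b (Suc x') = var (Suc x', y) * ?b x' - var (x, y) * cell_binomial x' y"
    by (simp add: cell_binomial_def algebra_simps)
  also have "\<dots> \<in> saturation V I"
  proof (rule poly_ideal_diff[OF S])
    show "var (Suc x', y) * ?b x' \<in> saturation V I"
      using v step.IH step.prems by (intro poly_ideal_mult[OF S _ step.IH]) auto
    show "var (x, y) * cell_binomial x' y \<in> saturation V I"
      using v c by (intro poly_ideal_mult[OF S]) auto
  qed
  finally have b: "var (x', y) * ?b (Suc x') \<in> saturation V I" .
  show ?case
    using v by (intro saturation_cancel_var[OF I finite_V v(1) _ b]) auto
qed

lemma interval_binomial:
  assumes I: "ideal I (poly_ring V :: (point, 'k::field) mpoly ring)"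
    and "x \<le> x'" "y \<le> y'"
    and v: "(x, y) \<in> V" "(x', y) \<in> V"
    and cells: "\<And>p q. x \<le> p \<Longrightarrow> p < x' \<Longrightarrow> y \<le> q \<Longrightarrow> q < y' \<Longrightarrow> cell (p, q) \<in> P \<and> cell_binomial p q \<in> saturation V I"
  shows "var (x, y) * var (x', y') - var (x, y') * var (x', y) \<in> saturation V I"
proof (cases "x = x'")
  case True
  then show ?thesis
    using poly_ideal_0[OF saturation_ideal[OF I]] by (simp add: mult.commute)
next
  case False
  then have "x < x'"
    using assms(2) by simp
  note S = saturation_ideal[OF I]
  show ?thesis
    using assms(3) cells
  proof (induction y' rule: dec_induct)
    case base
    then show ?case
      using poly_ideal_0[OF S] by simp
  next
    case (step y')
    let ?b = "\<lambda>y'. var (x, y) * var (x', y') - var (x, y') * var (x', y)"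
    let ?s = "var (x, y') * var (x', Suc y') - var (x, Suc y') * var (x', y')"
    have c: "cell (x, y') \<in> P" "cell (x' - 1, y') \<in> P"
      using step.prems[of x y'] step.prems[of "x' - 1" y'] step.hyps \<open>x < x'\<close> by auto
    note w = cell_vertices[OF c(1)] cell_vertices[OF c(2)]
    have "?s \<in> saturation V I"
      using step.prems step.hyps \<open>x < x'\<close> by (intro strip_binomial[OF I]) auto
    moreover have "?b y' \<in> saturation V I"
      using step.prems step.hyps by (intro step.IH) auto
    ultimately have "var (x, Suc y') * ?b y' + var (x, y) * ?s \<in> saturation V I"
      using poly_ideal_add[OF S poly_ideal_mult[OF S poly_carrier_var[OF w(3)]]
        poly_ideal_mult[OF S poly_carrier_var[OF v(1)]]] by blast
    also have "var (x, Suc y') * ?b y' + var (x, y) * ?s = var (x, y') * ?b (Suc y')"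
      by (simp add: algebra_simps)
    finally have b: "var (x, y') * ?b (Suc y') \<in> saturation V I" .
    have "(x', Suc y') \<in> V"
      using w(8) \<open>x < x'\<close> by simp
    then have "?b (Suc y') \<in> carrier (poly_ring V)"
      using w v by (intro poly_carrier_diff poly_carrier_mult poly_carrier_var)
    then show ?case
      using saturation_cancel_var[OF I finite_V w(1) _ b] by blast
  qed
qed

definition chain :: "nat \<Rightarrow> nat \<Rightarrow> nat \<Rightarrow> bool" where
  "chain a b n \<longleftrightarrow> (a, b) \<in> V \<and> (\<forall>i<n. cell (a + i, b - Suc i) \<in> P)"

lemma chain_mono: "chain a b n \<Longrightarrow> m \<le> n \<Longrightarrow> chain a b m"
  by (auto simp: chain_def)

lemma chain_less:
  assumes "chain a b n"
  shows "n < b"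
proof (cases n)
  case 0
  then show ?thesis
    using assms vertex_pos[of a b] by (simp add: chain_def)
next
  case (Suc m)
  then have "cell (a + m, b - Suc m) \<in> P"
    using assms by (simp add: chain_def)
  from cell_pos[OF this] show ?thesis
    using Suc by simp
qed

lemma chain_lower_left:
  assumes "chain a b n" "Suc i \<le> n" "j \<le> i"
  shows "cell (a + j, b - Suc i) \<in> P"
proof (rule lower_left_cell)
  show "(a, b) \<in> V" "cell (a + i, b - Suc i) \<in> P"
    using assms by (auto simp: chain_def)
  show "b - Suc i < b"
    using chain_less[OF assms(1)] by simp
qed (use assms(3) in auto)

lemma chain_vertex:
  assumes "chain a b n" "i \<le> n" "j \<le> i"
  shows "(a + j, b - i) \<in> V"
proof (cases i)
  case 0
  then show ?thesis
    using assms by (simp add: chain_def)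
next
  case (Suc i')
  show ?thesis
  proof (cases "j = i")
    case True
    then show ?thesis
      using cell_vertices(2)[OF chain_lower_left[of a b n i' i']] assms Suc by simp
  next
    case False
    then show ?thesis
      using cell_vertices(1)[OF chain_lower_left[of a b n i' j]] assms Suc by simp
  qed
qed

lemma chain_upper_vertex:
  assumes "chain a b n" "i < n"
  shows "(a + Suc i, b - i) \<in> V"
  using cell_vertices(4)[OF chain_lower_left[of a b n i i]] assms chain_less[OF assms(1)]
  by (simp add: Suc_diff_Suc)

lemma hessenberg_carrier:
  assumes "chain a b n" "\<And>i. i \<le> n \<Longrightarrow> (a + i, y) \<in> V"
  shows "(hessenberg a b n y :: (point, 'k::field) mpoly) \<in> carrier (poly_ring V)"
  using assms
proof (induction n arbitrary: y)
  case (Suc n)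
  have ch: "chain a b n"
    using Suc.prems(1) by (rule chain_mono) simp
  have "(hessenberg a b n (b - n) :: (point, 'k) mpoly) \<in> carrier (poly_ring V)"
    using ch chain_vertex[OF ch] by (intro Suc.IH) auto
  moreover have "(hessenberg a b n y :: (point, 'k) mpoly) \<in> carrier (poly_ring V)"
    using ch Suc.prems(2) by (intro Suc.IH) auto
  ultimately show ?case
    using Suc.prems(2)[of "Suc n"] chain_upper_vertex[OF Suc.prems(1), of n] by simp
qed (use assms in force)

lemma chain_hessenberg_carrier: "chain a b n \<Longrightarrow> hessenberg a b n (b - n) \<in> carrier (poly_ring V)"
  using chain_vertex[of a b n n] by (intro hessenberg_carrier) auto

text \<open>\<^term>\<open>hessenberg a b n y\<close> is linear in the variables of row \<open>y\<close>.\<close>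

lemma hessenberg_proportional:
  assumes S: "ideal S (poly_ring V :: (point, 'k::field) mpoly ring)"
    and "chain a b n"
    and "\<And>i. i \<le> n \<Longrightarrow> p * var (a + i, y) - q * var (a + i, y') \<in> S"
  shows "p * hessenberg a b n y - q * hessenberg a b n y' \<in> S"
  using assms(2,3)
proof (induction n)
  case (Suc n)
  have ch: "chain a b n"
    using Suc.prems(1) by (rule chain_mono) simp
  have "hessenberg a b n (b - n) * (p * var (a + Suc n, y) - q * var (a + Suc n, y')) \<in> S"
    using Suc.prems(2)[of "Suc n"] by (intro poly_ideal_mult[OF S] chain_hessenberg_carrier[OF ch]) simp
  moreover have "var (a + Suc n, b - n) * (p * hessenberg a b n y - q * hessenberg a b n y') \<in> S"
    using chain_upper_vertex[OF Suc.prems(1), of n] Suc.prems(2)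
    by (intro poly_ideal_mult[OF S] poly_carrier_var Suc.IH[OF ch]) auto
  ultimately have "hessenberg a b n (b - n) * (p * var (a + Suc n, y) - q * var (a + Suc n, y'))
      - var (a + Suc n, b - n) * (p * hessenberg a b n y - q * hessenberg a b n y') \<in> S"
    by (rule poly_ideal_diff[OF S])
  then show ?case
    by (simp add: algebra_simps)
qed (use assms in force)

lemma chain_step:
  assumes I: "ideal I (poly_ring V :: (point, 'k::field) mpoly ring)"
    and ch: "chain a b (Suc n)"
    and z: "\<And>x y. cell (x, y) \<in> P \<Longrightarrow> Suc (x + y) < a + b \<Longrightarrow> cell_binomial x y \<in> saturation V I"
  shows "var (a + n, b - n) * hessenberg a b (Suc n) (b - Suc n)
    - cell_binomial (a + n) (b - Suc n) * hessenberg a b n (b - n) \<in> saturation V I"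
proof -
  note S = saturation_ideal[OF I]
  define y where "y = b - Suc n"
  have y: "b - n = Suc y"
    using chain_less[OF ch] by (simp add: y_def)
  have "var (a + n, y) * hessenberg a b n (Suc y) - var (a + n, Suc y) * hessenberg a b n y \<in> saturation V I"
  proof (rule hessenberg_proportional[OF S])
    show "chain a b n"
      using ch by (rule chain_mono) simp
    fix i assume "i \<le> n"
    have "var (a + i, y) * var (a + n, Suc y) - var (a + i, Suc y) * var (a + n, y) \<in> saturation V I"
    proof (rule strip_binomial[OF I])
      fix p assume p: "a + i \<le> p" "p < a + n"
      then have c: "cell (p, y) \<in> P"
        using chain_lower_left[OF ch, of n "p - a"] by (simp add: y_def)
      with p show "cell (p, y) \<in> P \<and> cell_binomial p y \<in> saturation V I"
        using z[OF c] y chain_less[OF ch] by simp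
    qed (use \<open>i \<le> n\<close> in simp)
    then have "0 - (var (a + i, y) * var (a + n, Suc y) - var (a + i, Suc y) * var (a + n, y)) \<in> saturation V I"
      by (rule poly_ideal_diff[OF S poly_ideal_0[OF S]])
    then show "var (a + n, y) * var (a + i, Suc y) - var (a + n, Suc y) * var (a + i, y) \<in> saturation V I"
      by (simp add: algebra_simps)
  qed
  then have "var (a + Suc n, Suc y) *
      (var (a + n, y) * hessenberg a b n (Suc y) - var (a + n, Suc y) * hessenberg a b n y) \<in> saturation V I"
    using chain_upper_vertex[OF ch, of n] y by (intro poly_ideal_mult[OF S]) auto
  then show ?thesis
    unfolding y y_def[symmetric] by (simp add: cell_binomial_def algebra_simps y)
qed

lemma chain_product:
  assumes I: "ideal I (poly_ring V :: (point, 'k::field) mpoly ring)"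
    and "chain a b n"
    and z: "\<And>x y. cell (x, y) \<in> P \<Longrightarrow> Suc (x + y) < a + b \<Longrightarrow> cell_binomial x y \<in> saturation V I"
  shows "(\<Prod>i<n. var (a + i, b - i)) * hessenberg a b n (b - n)
    - var (a, b) * (\<Prod>i<n. cell_binomial (a + i) (b - Suc i)) \<in> saturation V I"
  using assms(2)
proof (induction n)
  case 0
  then show ?case
    using poly_ideal_0[OF saturation_ideal[OF I]] by simp
next
  case (Suc n)
  note S = saturation_ideal[OF I]
  let ?v = "\<Prod>i<n. var (a + i, b - i)" and ?z = "\<Prod>i<n. cell_binomial (a + i) (b - Suc i)"
  have ch: "chain a b n"
    using Suc.prems by (rule chain_mono) simp
  have v: "?v \<in> carrier (poly_ring V)"
    using chain_vertex[OF ch] by (intro poly_carrier_prod poly_carrier_var) auto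
  have "cell (a + n, b - Suc n) \<in> P"
    using Suc.prems by (simp add: chain_def)
  then have zn: "cell_binomial (a + n) (b - Suc n) \<in> carrier (poly_ring V)"
    by (rule cell_binomial_carrier)
  have "?v * (var (a + n, b - n) * hessenberg a b (Suc n) (b - Suc n)
        - cell_binomial (a + n) (b - Suc n) * hessenberg a b n (b - n))
      + cell_binomial (a + n) (b - Suc n) * (?v * hessenberg a b n (b - n) - var (a, b) * ?z) \<in> saturation V I"
    by (rule poly_ideal_add[OF S poly_ideal_mult[OF S v chain_step[OF I Suc.prems z]]
        poly_ideal_mult[OF S zn Suc.IH[OF ch]]])
  then show ?case
    by (simp add: algebra_simps del: hessenberg.simps)
qed

end

lemma torus_simps [simp]:
  "torus Q 0 = 0"
  "torus Q (p + q) = torus Q p + torus Q q"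
  "torus Q (p - q) = torus Q p - torus Q q"
  "torus Q (p * q) = torus Q p * torus Q q"
  "torus Q (prod g A) = (\<Prod>i\<in>A. torus Q (g i))"
  "torus Q (p ^ n) = torus Q p ^ n"
  by (simp_all add: torus_def laurent_prod laurent_power)

lemma torus_var_neq_0 [simp]: "torus Q (var v :: (point, 'k::field) mpoly) \<noteq> 0"
  unfolding torus_def by (rule laurent_var_neq_0)

lemma torus_saturation:
  assumes "p \<in> saturation V I" "\<And>q. q \<in> I \<Longrightarrow> torus Q q = 0" "finite V"
  shows "torus Q p = 0"
proof -
  obtain N where "(\<Prod>v\<in>V. var v) ^ N * p \<in> I"
    using assms(1) by (auto simp: saturation_def)
  then have "torus Q ((\<Prod>v\<in>V. var v) ^ N * p) = 0"
    by (rule assms(2))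
  then show ?thesis
    using assms(3) by simp
qed

context ladder_cells
begin

definition cells_below :: "nat \<Rightarrow> point set" where
  "cells_below k = {(x, y). cell (x, y) \<in> P \<and> x + y < k}"

lemma knutson_cell_step:
  fixes f :: "(point, 'k::field) mpoly"
  assumes f: "f \<in> carrier (poly_ring V)" "f \<noteq> 0"
    and ch: "chain a b n" "j < n"
    and factor: "f = hessenberg a b n (b - n) * g" "g \<in> carrier (poly_ring V)"
    and I: "I \<in> knutson_class0 V f" "\<And>p. p \<in> I \<Longrightarrow> torus (cells_below (a + b - 1)) p = 0"
    and z: "\<And>x y. (x, y) \<in> cells_below (a + b - 1) \<Longrightarrow> cell_binomial x y \<in> saturation V I"
  shows "\<exists>I' \<in> knutson_class (poly_ring V) f.
    (\<forall>p\<in>I'. torus (insert (a + j, b - Suc j) (cells_below (a + b - 1))) p = 0) \<and>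
    cell_binomial (a + j) (b - Suc j) \<in> saturation V I'"
proof -
  define Q where "Q = cells_below (a + b - 1)"
  define Q' where "Q' = insert (a + j, b - Suc j) Q"
  define D :: "(point, 'k) mpoly" where "D = hessenberg a b n (b - n)"
  define z' :: "(point, 'k) mpoly" where "z' = (\<Prod>i\<in>{..<n} - {j}. cell_binomial (a + i) (b - Suc i))"
  define J where "J = {p + q | p q. p \<in> I \<and> q \<in> PIdl\<^bsub>poly_ring V\<^esub> D}"
  define I' where "I' = {p \<in> carrier (poly_ring V). p * z' \<in> J}"
  have "n < b"
    using ch(1) by (rule chain_less)
  have chain_cell: "cell (a + i, b - Suc i) \<in> P" if "i < n" for i
    using ch(1) that by (simp add: chain_def)
  have D: "D \<in> carrier (poly_ring V)"
    unfolding D_def using ch(1) by (rule chain_hessenberg_carrier)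
  have z': "z' \<in> carrier (poly_ring V)"
    unfolding z'_def using chain_cell by (intro poly_carrier_prod cell_binomial_carrier) auto
  have I_ideal: "ideal I (poly_ring V)"
    using I(1) f(1) by (rule knutson_class0_ideal)
  have zI: "cell_binomial x y \<in> saturation V I" if "cell (x, y) \<in> P" "Suc (x + y) < a + b" for x y
    using that by (intro z) (auto simp: cells_below_def)
  have prod_eq: "(\<Prod>i<n. cell_binomial (a + i) (b - Suc i)) = cell_binomial (a + j) (b - Suc j) * z'"
    unfolding z'_def using ch(2) by (simp add: prod.remove)
  have rel: "(\<Prod>i<n. var (a + i, b - i)) * D - var (a, b) * (cell_binomial (a + j) (b - Suc j) * z') \<in> saturation V I"
    using chain_product[OF I_ideal ch(1) zI] by (simp add: D_def prod_eq)

  have "J \<in> knutson_class (poly_ring V) f"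
    unfolding J_def D_def[symmetric]
    using knutson_class0_sum[OF I(1) knutson_class_factor[OF factor(1) f(2) _ factor(2)]] D
    by (simp add: D_def)
  then have J: "ideal J (poly_ring V)" and I'_class: "I' \<in> knutson_class (poly_ring V) f"
    unfolding I'_def using f(1) z' by (auto intro: knutson_class_ideal knutson_class_colon)
  have "0 \<in> PIdl\<^bsub>poly_ring V\<^esub> D" "D \<in> PIdl\<^bsub>poly_ring V\<^esub> D"
    by (auto simp: poly_PIdl intro: exI[of _ 0] exI[of _ 1])
  then have IJ: "I \<subseteq> J" and DJ: "D \<in> J"
    unfolding J_def using poly_ideal_0[OF I_ideal] by force+

  have torus_I: "torus Q' p = 0" if "p \<in> I" for p
    using I(2)[OF that] by (rule torus_mono) (auto simp: Q'_def Q_def)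
  have "torus Q' (cell_binomial (a + j) (b - Suc j) :: (point, 'k) mpoly) = 0"
    by (rule torus_cell_binomial_mem) (simp add: Q'_def)
  then have torus_D: "torus Q' D = 0"
    using torus_saturation[OF rel torus_I finite_V] by simp
  have torus_J: "torus Q' p = 0" if "p \<in> J" for p
    using that torus_I torus_D by (auto simp: J_def poly_PIdl)
  have "torus Q' (cell_binomial (a + i) (b - Suc i) :: (point, 'k) mpoly) \<noteq> 0" if "i < n" "i \<noteq> j" for i
    using that \<open>n < b\<close> by (intro torus_cell_binomial_not_mem) (auto simp: Q'_def Q_def cells_below_def)
  then have "torus Q' z' \<noteq> 0"
    by (simp add: z'_def)
  moreover have "torus Q' p * torus Q' z' = 0" if "p \<in> I'" for p
    using that torus_J[of "p * z'"] by (simp add: I'_def)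
  ultimately have torus_I': "torus Q' p = 0" if "p \<in> I'" for p
    using that by simp

  have "cell_binomial (a + j) (b - Suc j) * z' \<in> saturation V J"
  proof (rule saturation_cancel_var[OF J finite_V])
    note S = saturation_ideal[OF J]
    show "(a, b) \<in> V"
      using ch(1) by (simp add: chain_def)
    show "cell_binomial (a + j) (b - Suc j) * z' \<in> carrier (poly_ring V)"
      using z' chain_cell[OF ch(2)] by (simp add: cell_binomial_carrier)
    have "(\<Prod>i<n. var (a + i, b - i)) * D \<in> saturation V J"
      using DJ saturation_superset[OF poly_ideal_subset[OF J]] chain_vertex[OF ch(1)]
      by (intro poly_ideal_mult[OF S] poly_carrier_prod) auto
    then have "(\<Prod>i<n. var (a + i, b - i)) * D -
        ((\<Prod>i<n. var (a + i, b - i)) * D - var (a, b) * (cell_binomial (a + j) (b - Suc j) * z')) \<in> saturation V J"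
      by (rule poly_ideal_diff[OF S]) (use rel saturation_mono[OF IJ] in blast)
    then show "var (a, b) * (cell_binomial (a + j) (b - Suc j) * z') \<in> saturation V J"
      by simp
  qed
  then obtain N where "(\<Prod>v\<in>V. var v) ^ N * (cell_binomial (a + j) (b - Suc j) * z') \<in> J"
    by (auto simp: saturation_def)
  then have "(\<Prod>v\<in>V. var v) ^ N * cell_binomial (a + j) (b - Suc j) \<in> I'"
    using chain_cell[OF ch(2)] by (simp add: I'_def cell_binomial_carrier mult.assoc)
  then have "cell_binomial (a + j) (b - Suc j) \<in> saturation V I'"
    using chain_cell[OF ch(2)] by (auto simp: saturation_def cell_binomial_carrier)
  then show ?thesis
    using I'_class torus_I' unfolding Q'_def Q_def by blast
qed

definition chain_factors :: "(point, 'k::field) mpoly \<Rightarrow> bool" where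
  "chain_factors f \<longleftrightarrow> (\<forall>x y. cell (x, y) \<in> P \<longrightarrow>
     (\<exists>a b n j g. chain a b n \<and> j < n \<and> x = a + j \<and> y = b - Suc j \<and>
        g \<in> carrier (poly_ring V) \<and> f = hessenberg a b n (b - n) * g))"

lemma finite_cells: "finite {(x, y). cell (x, y) \<in> P}"
  by (rule finite_subset[OF _ finite_V]) (auto dest: cell_vertices)

lemma knutson_layer:
  fixes f :: "(point, 'k::field) mpoly"
  assumes f: "f \<in> carrier (poly_ring V)" "f \<noteq> 0" "chain_factors f"
  shows "\<exists>I \<in> knutson_class0 V f. (\<forall>p\<in>I. torus (cells_below k) p = 0) \<and>
    (\<forall>(x, y)\<in>cells_below k. cell_binomial x y \<in> saturation V I)"
proof (induction k)
  case 0
  show ?case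
    by (intro bexI[of _ "{0}"]) (auto simp: cells_below_def knutson_class0_def)
next
  case (Suc k)
  then obtain I where I: "I \<in> knutson_class0 V f" "\<forall>p\<in>I. torus (cells_below k) p = 0"
    "\<forall>(x, y)\<in>cells_below k. cell_binomial x y \<in> saturation V I"
    by blast
  define T where "T = {(x, y). cell (x, y) \<in> P \<and> x + y = k}"
  have "finite T"
    by (rule finite_subset[OF _ finite_cells]) (auto simp: T_def)
  moreover have "T \<subseteq> T"
    by simp
  ultimately have "\<exists>I' \<in> knutson_class0 V f. (\<forall>p\<in>I'. torus (cells_below (Suc k)) p = 0) \<and>
      (\<forall>(x, y)\<in>cells_below k \<union> T. cell_binomial x y \<in> saturation V I')"
  proof (induction T rule: finite_subset_induct)
    case empty
    have "torus (cells_below (Suc k)) p = 0" if "p \<in> I" for p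
      by (rule torus_mono[of "cells_below k"]) (use I(2) that in \<open>auto simp: cells_below_def\<close>)
    then show ?case
      using I by (intro bexI[of _ I]) auto
  next
    case (insert c T')
    then obtain I\<^sub>1 where I1: "I\<^sub>1 \<in> knutson_class0 V f" "\<forall>p\<in>I\<^sub>1. torus (cells_below (Suc k)) p = 0"
      "\<forall>(x, y)\<in>cells_below k \<union> T'. cell_binomial x y \<in> saturation V I\<^sub>1"
      by blast
    obtain x y where c: "c = (x, y)" "cell (x, y) \<in> P" "x + y = k"
      using insert.hyps(2) by (auto simp: T_def)
    from f(3) c(2) obtain a b n j g where ch: "chain a b n" "j < n" "x = a + j" "y = b - Suc j"
      "g \<in> carrier (poly_ring V)" "f = hessenberg a b n (b - n) * g"
      unfolding chain_factors_def by blast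
    have k: "a + b - 1 = k"
      using c(3) ch(2-4) chain_less[OF ch(1)] by simp
    have "\<exists>I' \<in> knutson_class (poly_ring V) f.
        (\<forall>p\<in>I'. torus (insert (a + j, b - Suc j) (cells_below (a + b - 1))) p = 0) \<and>
        cell_binomial (a + j) (b - Suc j) \<in> saturation V I'"
      by (rule knutson_cell_step[OF f(1,2) ch(1,2,6,5) I(1)]) (use I k in auto)
    then obtain I\<^sub>2 where I2: "I\<^sub>2 \<in> knutson_class (poly_ring V) f"
      "\<forall>p\<in>I\<^sub>2. torus (insert c (cells_below k)) p = 0" "cell_binomial x y \<in> saturation V I\<^sub>2"
      unfolding k ch(3,4)[symmetric] c(1) by blast
    define I' where "I' = {p + q | p q. p \<in> I\<^sub>1 \<and> q \<in> I\<^sub>2}"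
    have "I' \<in> knutson_class0 V f"
      using knutson_class0_sum[OF I1(1) I2(1)] by (simp add: I'_def knutson_class0_def)
    moreover have "torus (cells_below (Suc k)) p = 0" if "p \<in> I\<^sub>2" for p
      by (rule torus_mono[of "insert c (cells_below k)"])
        (use I2(2) that c in \<open>auto simp: cells_below_def\<close>)
    then have "\<forall>p\<in>I'. torus (cells_below (Suc k)) p = 0"
      using I1(2) by (auto simp: I'_def)
    moreover have "I\<^sub>1 \<subseteq> I'" "I\<^sub>2 \<subseteq> I'"
      using poly_ideal_0[OF knutson_class0_ideal[OF I1(1) f(1)]]
        poly_ideal_0[OF knutson_class_ideal[OF I2(1) f(1)]]
      unfolding I'_def by force+
    then have "\<forall>(x, y)\<in>cells_below k \<union> insert c T'. cell_binomial x y \<in> saturation V I'"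
      using saturation_mono[of I\<^sub>1 I' V] saturation_mono[of I\<^sub>2 I' V] I1(3) I2(3) c(1)
      by (auto dest!: bspec[OF I1(3)])
    ultimately show ?case
      by blast
  qed
  moreover have "cells_below (Suc k) = cells_below k \<union> T"
    by (auto simp: cells_below_def T_def)
  ultimately show ?case
    by auto
qed

lemma inner_interval_saturation:
  assumes I: "ideal I (poly_ring V :: (point, 'k::field) mpoly ring)"
    and z: "\<And>x y. cell (x, y) \<in> P \<Longrightarrow> cell_binomial x y \<in> saturation V I"
    and "inner_interval P a b"
  shows "var a * var b - var (upper_left a b) * var (lower_right a b) \<in> saturation V I"
proof -
  obtain x y x' y' where ab: "a = (x, y)" "b = (x', y')"
    by (cases a, cases b)
  have xy: "x < x'" "y < y'" "(x, y) \<in> V"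
    using assms(3) by (auto simp: inner_interval_def proper_interval_def ab)
  have cells: "cell (p, q) \<in> P" if "x \<le> p" "p < x'" "y \<le> q" "q < y'" for p q
  proof -
    have "cell (p, q) \<subseteq> {a..b}"
      using that by (auto simp: cell_eq ab)
    then show ?thesis
      using assms(3) by (auto simp: inner_interval_def)
  qed
  have "(x', y) \<in> V"
    using cell_vertices(2)[OF cells[of "x' - 1" y]] xy by simp
  then show ?thesis
    unfolding ab upper_left_def lower_right_def fst_conv snd_conv
    using xy cells z by (intro interval_binomial[OF I]) auto
qed

lemma polyomino_ideal_knutson_class:
  fixes f :: "(point, 'k::field) mpoly"
  assumes f: "f \<in> carrier (poly_ring V)" "f \<noteq> 0" "chain_factors f"
    and "P \<noteq> {}"
    and ker: "\<And>p :: (point, 'k) mpoly. p \<in> carrier (poly_ring V) \<Longrightarrow>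
      torus {(x, y). cell (x, y) \<in> P} p = 0 \<Longrightarrow> p \<in> polyomino_ideal P"
  shows "polyomino_ideal P \<in> knutson_class (poly_ring V) f"
proof -
  let ?A = "{(x, y). cell (x, y) \<in> P}"
  obtain k where "\<forall>n\<in>(\<lambda>(x, y). x + y) ` ?A. n < k"
    using finite_nat_set_iff_bounded finite_imageI[OF finite_cells] by metis
  then have "cells_below k = ?A"
    by (auto simp: cells_below_def)
  then obtain I where I: "I \<in> knutson_class0 V f" "\<And>p. p \<in> I \<Longrightarrow> torus ?A p = 0"
    and z: "\<And>x y. cell (x, y) \<in> P \<Longrightarrow> cell_binomial x y \<in> saturation V I"
    using knutson_layer[OF f, of k] by auto
  have I_ideal: "ideal I (poly_ring V)"
    using I(1) f(1) by (rule knutson_class0_ideal)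
  obtain x y where "cell (x, y) \<in> P"
    using assms(4) P_cells by (metis all_not_in_conv surj_pair)
  have "I \<noteq> {0}"
  proof
    assume "I = {0}"
    then have "torus {} (cell_binomial x y :: (point, 'k) mpoly) = 0"
      using torus_saturation[OF z[OF \<open>cell (x, y) \<in> P\<close>] _ finite_V, of "{}"] by simp
    then show False
      using torus_cell_binomial_not_mem[of x y "{}"] by auto
  qed
  then have I_class: "I \<in> knutson_class (poly_ring V) f"
    using I(1) by (simp add: knutson_class0_def)
  define G :: "(point, 'k) mpoly set" where
    "G = {var a * var b - var (upper_left a b) * var (lower_right a b) | a b. inner_interval P a b}"
  have "G \<subseteq> (\<lambda>(a, b). var a * var b - var (upper_left a b) * var (lower_right a b)) ` (V \<times> V)"
    by (auto simp: G_def inner_interval_def)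
  then have "finite G"
    by (rule finite_subset) (simp add: finite_V)
  moreover have G: "G \<subseteq> saturation V I"
    using inner_interval_saturation[OF I_ideal z] by (auto simp: G_def)
  ultimately obtain N where N: "\<forall>p\<in>G. (\<Prod>v\<in>V. var v) ^ N * p \<in> I"
    using saturation_common_witness[OF I_ideal] by blast
  define s :: "(point, 'k) mpoly" where "s = (\<Prod>v\<in>V. var v) ^ N"
  have s: "s \<in> carrier (poly_ring V)"
    unfolding s_def by (intro poly_carrier_power poly_carrier_prod poly_carrier_var)
  define K where "K = {p \<in> carrier (poly_ring V). p * s \<in> I}"
  have K_class: "K \<in> knutson_class (poly_ring V) f"
    unfolding K_def using I_class f(1) s by (rule knutson_class_colon)
  have "G \<subseteq> K"
    using N G by (auto simp: K_def s_def saturation_def mult.commute)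
  then have "polyomino_ideal P \<subseteq> K"
    unfolding polyomino_ideal_def G_def[symmetric]
    by (intro ring.genideal_minimal cring.axioms(1)[OF cring_poly_ring] knutson_class_ideal[OF K_class f(1)])
  moreover have "K \<subseteq> polyomino_ideal P"
  proof
    fix p assume p: "p \<in> K"
    then have "torus ?A p * torus ?A s = 0"
      using I(2)[of "p * s"] by (simp add: K_def)
    moreover have "torus ?A s \<noteq> 0"
      by (simp add: s_def finite_V)
    ultimately show "p \<in> polyomino_ideal P"
      using p by (intro ker) (auto simp: K_def)
  qed
  ultimately show ?thesis
    using K_class by simp
qed

end

section \<open>Straightening\<close>

lemma monomial_split:
  assumes "v \<in> Poly_Mapping.keys (m :: 'x monomial)"
  obtains m' where "m = monom v 1 + m'"
proof
  show "m = monom v 1 + (m - monom v 1)"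
    using assms by (intro poly_mapping_eqI)
      (auto simp: lookup_add lookup_minus lookup_single when_def in_keys_iff)
qed

lemma keys_monomial_add:
  "Poly_Mapping.keys (m + n :: 'x monomial) = Poly_Mapping.keys m \<union> Poly_Mapping.keys n"
  by (auto simp: in_keys_iff lookup_add)

definition total_degree :: "'x monomial \<Rightarrow> nat" where
  "total_degree m = (\<Sum>v\<in>Poly_Mapping.keys m. Poly_Mapping.lookup m v)"

lemma total_degree_add: "total_degree (m + n) = total_degree m + total_degree n"
  unfolding total_degree_def by (rule setsum_keys_plus_distrib) auto

lemma total_degree_single [simp]: "total_degree (monom v (Suc 0)) = 1"
  by (simp add: total_degree_def)

lemma top_right_exists:
  fixes A :: "point set"
  assumes "finite A" "A \<noteq> {}"
  obtains x y where "(x, y) \<in> A" "\<And>p q. (p, q) \<in> A \<Longrightarrow> q \<le> y" "\<And>p. (p, y) \<in> A \<Longrightarrow> p \<le> x"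
proof -
  define y where "y = Max (snd ` A)"
  define B where "B = {p. (p, y) \<in> A}"
  have "y \<in> snd ` A"
    unfolding y_def using assms by (intro Max_in) auto
  then have "B \<noteq> {}"
    by (auto simp: B_def)
  moreover have "finite B"
    by (rule finite_subset[of _ "fst ` A"]) (use assms in \<open>force simp: B_def\<close>)+
  ultimately have "Max B \<in> B" "\<And>p. p \<in> B \<Longrightarrow> p \<le> Max B"
    by auto
  moreover have "q \<le> y" if "(p, q) \<in> A" for p q
    unfolding y_def using assms(1) that by (intro Max_ge) force+
  ultimately show ?thesis
    using that[of "Max B" y] by (auto simp: B_def)
qed

context ladder_cells
begin

definition vertical_edge :: "nat \<Rightarrow> nat \<Rightarrow> bool" where
  "vertical_edge x y \<longleftrightarrow> cell (x, y) \<in> P \<or> cell (x - 1, y) \<in> P"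

primrec run_start :: "nat \<Rightarrow> nat \<Rightarrow> nat" where
  "run_start x 0 = 0"
| "run_start x (Suc y) = (if vertical_edge x y then run_start x y else Suc y)"

lemma run_start_le: "run_start x y \<le> y"
  by (induction y) auto

lemma run_start_eq_iff:
  assumes "y \<le> y'"
  shows "run_start x y = run_start x y' \<longleftrightarrow> (\<forall>h\<in>{y..<y'}. vertical_edge x h)"
  using assms
proof (induction y' rule: dec_induct)
  case (step n)
  have "run_start x y \<noteq> Suc n"
    using run_start_le[of x y] step.hyps by simp
  then show ?case
    using step by (auto simp: less_Suc_eq)
qed auto

text \<open>The row of a vertex and its maximal vertical interval, numbered disjointly.\<close>

definition row_run :: "point \<Rightarrow> nat \<Rightarrow>\<^sub>0 int" where
  "row_run v = frag_of (2 * snd v) + frag_of (Suc (2 * prod_encode (fst v, run_start (fst v) (snd v))))"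

lemma row_run_cell:
  assumes "cell (x, y) \<in> P"
  shows "row_run (Suc x, Suc y) = row_run (x, Suc y) + row_run (Suc x, y) - row_run (x, y)"
  using assms by (simp add: row_run_def vertical_edge_def)

lemma lookup_row_run_nonneg: "0 \<le> Poly_Mapping.lookup (row_run v) k"
  by (simp add: row_run_def lookup_add)

lemma row_run_key:
  assumes eq: "monomial_map row_run m = monomial_map row_run m'"
    and "v \<in> Poly_Mapping.keys m" "Poly_Mapping.lookup (row_run v) k \<noteq> 0"
  shows "\<exists>v'\<in>Poly_Mapping.keys m'. Poly_Mapping.lookup (row_run v') k \<noteq> 0"
proof (rule ccontr)
  assume "\<not> ?thesis"
  then have "Poly_Mapping.lookup (monomial_map row_run m') k = 0"
    by (auto simp: lookup_monomial_map)
  then have "(\<Sum>v\<in>Poly_Mapping.keys m. int (Poly_Mapping.lookup m v) * Poly_Mapping.lookup (row_run v) k) = 0"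
    by (simp add: lookup_monomial_map flip: eq)
  then have "int (Poly_Mapping.lookup m v) * Poly_Mapping.lookup (row_run v) k = 0"
    using assms(2) by (subst (asm) sum_nonneg_eq_0_iff) (auto simp: lookup_row_run_nonneg)
  then show False
    using assms(2,3) by (simp add: in_keys_iff)
qed

lemma same_row:
  assumes "monomial_map row_run m = monomial_map row_run m'" "(x, y) \<in> Poly_Mapping.keys m"
  shows "\<exists>x'. (x', y) \<in> Poly_Mapping.keys m'"
proof -
  have "Poly_Mapping.lookup (row_run (x, y)) (2 * y) \<noteq> 0"
    by (simp add: row_run_def lookup_add)
  from row_run_key[OF assms this] obtain v' where
    "v' \<in> Poly_Mapping.keys m'" "Poly_Mapping.lookup (row_run v') (2 * y) \<noteq> 0"
    by blast
  moreover have "2 * y \<noteq> Suc (2 * k)" for k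
    by presburger
  ultimately show ?thesis
    by (cases v') (auto simp: row_run_def lookup_add split: if_splits)
qed

lemma same_run:
  assumes "monomial_map row_run m = monomial_map row_run m'" "(x, y) \<in> Poly_Mapping.keys m"
  shows "\<exists>y'. (x, y') \<in> Poly_Mapping.keys m' \<and> run_start x y' = run_start x y"
proof -
  let ?k = "Suc (2 * prod_encode (x, run_start x y))"
  have "Poly_Mapping.lookup (row_run (x, y)) ?k \<noteq> 0"
    by (simp add: row_run_def lookup_add)
  from row_run_key[OF assms this] obtain v' where
    "v' \<in> Poly_Mapping.keys m'" "Poly_Mapping.lookup (row_run v') ?k \<noteq> 0"
    by blast
  moreover have "Suc (2 * j) \<noteq> 2 * k" for j k
    by presburger
  ultimately show ?thesis
    by (cases v') (auto simp: row_run_def lookup_add split: if_splits)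
qed

lemma polyomino_ideal_ideal: "ideal (polyomino_ideal P :: (point, 'k::field) mpoly set) (poly_ring V)"
  and inner_interval_binomial_mem:
    "inner_interval P a b \<Longrightarrow>
      var a * var b - var (upper_left a b) * var (lower_right a b) \<in> (polyomino_ideal P :: (point, 'k) mpoly set)"
proof -
  let ?G = "{var a * var b - var (upper_left a b) * var (lower_right a b) :: (point, 'k) mpoly | a b.
    inner_interval P a b}"
  have "?G \<subseteq> carrier (poly_ring V)"
  proof clarify
    fix a b assume ab: "inner_interval P a b"
    obtain x y x' y' where xy: "a = (x, y)" "b = (x', y')"
      by (cases a, cases b)
    have "cell (x, y' - 1) \<subseteq> {a..b}" "cell (x' - 1, y) \<subseteq> {a..b}"
      using ab by (auto simp: inner_interval_def proper_interval_def cell_eq xy)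
    then have "cell (x, y' - 1) \<in> P" "cell (x' - 1, y) \<in> P"
      using ab by (auto simp: inner_interval_def)
    from cell_vertices(3)[OF this(1)] cell_vertices(2)[OF this(2)]
    have "(x, y') \<in> V" "(x', y) \<in> V"
      using ab by (auto simp: inner_interval_def proper_interval_def xy)
    then show "var a * var b - var (upper_left a b) * var (lower_right a b) \<in> carrier (poly_ring V)"
      using ab by (simp add: inner_interval_def upper_left_def lower_right_def xy)
  qed
  then show "ideal (polyomino_ideal P :: (point, 'k) mpoly set) (poly_ring V)"
    and "inner_interval P a b \<Longrightarrow>
      var a * var b - var (upper_left a b) * var (lower_right a b) \<in> (polyomino_ideal P :: (point, 'k) mpoly set)"
    unfolding polyomino_ideal_def
    using ring.genideal_ideal[OF cring.axioms(1)[OF cring_poly_ring]]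
      ring.genideal_self[OF cring.axioms(1)[OF cring_poly_ring]] by blast+
qed

text \<open>
  Going down the maximal vertical interval of \<open>(x', y)\<close>, the columns between \<open>x\<close> and \<open>x'\<close> stay in
  the polyomino because its left boundary recedes downwards.
\<close>

lemma swap:
  assumes eq: "monomial_map row_run m = monomial_map row_run m'"
    and V: "Poly_Mapping.keys m \<subseteq> V" "Poly_Mapping.keys m' \<subseteq> V"
    and top: "(x, y) \<in> Poly_Mapping.keys m" "\<forall>p q. (p, q) \<in> Poly_Mapping.keys m \<longrightarrow> q \<le> y"
      "\<forall>p. (p, y) \<in> Poly_Mapping.keys m \<longrightarrow> p \<le> x"
    and x': "(x', y) \<in> Poly_Mapping.keys m'" "x < x'"
  shows "\<exists>n. monomial_map row_run n = monomial_map row_run m' \<and> Poly_Mapping.keys n \<subseteq> V \<and>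
    (x', y) \<in> Poly_Mapping.keys n \<and> total_degree n = total_degree m \<and>
    monom m 1 - monom n 1 \<in> (polyomino_ideal P :: (point, 'k::field) mpoly set)"
proof -
  obtain y2 where y2: "(x', y2) \<in> Poly_Mapping.keys m" "run_start x' y2 = run_start x' y"
    using same_run[OF eq[symmetric] x'(1)] by blast
  have "y2 \<noteq> y"
    using y2(1) top(3) x'(2) by (meson not_less)
  then have "y2 < y"
    using top(2) y2(1) by (meson le_neq_implies_less)
  have cells: "cell (q, h) \<in> P" if "x \<le> q" "q < x'" "y2 \<le> h" "h < y" for q h
  proof -
    have "vertical_edge x' h"
      using run_start_eq_iff[of y2 y x'] y2(2) \<open>y2 < y\<close> that by simp
    then consider "cell (x', h) \<in> P" | "cell (x' - 1, h) \<in> P"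
      by (auto simp: vertical_edge_def)
    then show ?thesis
      using that V(1) top(1) by cases (auto intro: lower_left_cell[of x y _ h q])
  qed
  have v: "(x, y2) \<in> V" "(x', y2) \<in> V" "(x, y) \<in> V" "(x', y) \<in> V"
    using V top(1) y2(1) x'(1) cell_vertices(1)[OF cells[of x y2]] \<open>x < x'\<close> \<open>y2 < y\<close> by auto
  have "inner_interval P (x, y2) (x', y)"
    unfolding inner_interval_def proper_interval_def
    using v \<open>x < x'\<close> \<open>y2 < y\<close> cells by (auto simp: cell_eq)
  from inner_interval_binomial_mem[OF this]
  have g: "var (x, y2) * var (x', y) - var (x, y) * var (x', y2) \<in> (polyomino_ideal P :: (point, 'k) mpoly set)"
    by (simp add: upper_left_def lower_right_def)
  obtain m1 where m1: "m = monom (x, y) 1 + m1"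
    using top(1) by (rule monomial_split)
  have "(x', y2) \<in> Poly_Mapping.keys m1"
    using y2(1) \<open>x < x'\<close> by (auto simp: m1 keys_monomial_add)
  then obtain m0 where m0: "m1 = monom (x', y2) 1 + m0"
    by (rule monomial_split)
  define n where "n = monom (x, y2) 1 + (monom (x', y) 1 + m0)"
  have m: "m = monom (x, y) 1 + (monom (x', y2) 1 + m0)"
    by (simp add: m1 m0)
  have "run_start x y2 = run_start x y"
    using run_start_eq_iff[of y2 y x] \<open>y2 < y\<close> \<open>x < x'\<close> cells by (auto simp: vertical_edge_def)
  then have "row_run (x, y2) + row_run (x', y) = row_run (x, y) + row_run (x', y2)"
    using y2(2) by (simp add: row_run_def algebra_simps)
  then have "monomial_map row_run n = monomial_map row_run m"
    by (simp add: n_def m monomial_map_add add.assoc[symmetric])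
  moreover have "Poly_Mapping.keys n \<subseteq> V" "(x', y) \<in> Poly_Mapping.keys n" "total_degree n = total_degree m"
    using v V(1) by (auto simp: n_def m keys_monomial_add total_degree_add)
  moreover have "monom m 1 - monom n 1 \<in> (polyomino_ideal P :: (point, 'k) mpoly set)"
  proof -
    note S = polyomino_ideal_ideal
    have "monom m0 1 \<in> carrier (poly_ring V)"
      using V(1) by (auto simp: poly_carrier_iff m keys_monomial_add)
    then have "0 - monom m0 1 * (var (x, y2) * var (x', y) - var (x, y) * var (x', y2))
        \<in> (polyomino_ideal P :: (point, 'k) mpoly set)"
      using poly_ideal_diff[OF S poly_ideal_0[OF S] poly_ideal_mult[OF S _ g]] by blast
    also have "0 - monom m0 1 * (var (x, y2) * var (x', y) - var (x, y) * var (x', y2)) =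
        monom m (1 :: 'k) - monom n 1"
      by (simp add: m n_def var_def algebra_simps mult_single)
    finally show ?thesis .
  qed
  ultimately show ?thesis
    using eq by metis
qed

lemma straighten:
  assumes "monomial_map row_run m = monomial_map row_run m'"
    and "Poly_Mapping.keys m \<subseteq> V" "Poly_Mapping.keys m' \<subseteq> V"
  shows "monom m 1 - monom m' 1 \<in> (polyomino_ideal P :: (point, 'k::field) mpoly set)"
  using assms
proof (induction "total_degree m" arbitrary: m m' rule: less_induct)
  case less
  note S = polyomino_ideal_ideal
  have common: "monom n 1 - monom n' 1 \<in> (polyomino_ideal P :: (point, 'k::field) mpoly set)"
    if n: "total_degree n = total_degree m" "monomial_map row_run n = monomial_map row_run n'"
      "Poly_Mapping.keys n \<subseteq> V" "Poly_Mapping.keys n' \<subseteq> V"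
      and v: "v \<in> Poly_Mapping.keys n" "v \<in> Poly_Mapping.keys n'" for n n' v
  proof -
    obtain n1 n1' where n1: "n = monom v 1 + n1" and n1': "n' = monom v 1 + n1'"
      using v by (metis monomial_split)
    have "monom n1 1 - monom n1' 1 \<in> (polyomino_ideal P :: (point, 'k) mpoly set)"
      using n by (intro less.hyps) (auto simp: n1 n1' monomial_map_add keys_monomial_add total_degree_add
          simp flip: n(1))
    moreover have "v \<in> V"
      using v n by blast
    ultimately have "var v * (monom n1 1 - monom n1' 1) \<in> (polyomino_ideal P :: (point, 'k) mpoly set)"
      by (intro poly_ideal_mult[OF S]) auto
    then show ?thesis
      by (simp add: n1 n1' var_def algebra_simps mult_single)
  qed
  show ?case
  proof (cases "m = 0")
    case True
    have "m' = 0"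
    proof (rule ccontr)
      assume "m' \<noteq> 0"
      then obtain v where "v \<in> Poly_Mapping.keys m'"
        by (metis all_not_in_conv keys_eq_empty)
      then show False
        using same_row[OF less.prems(1)[symmetric], of "fst v" "snd v"] True by simp
    qed
    then show ?thesis
      using True poly_ideal_0[OF S] by simp
  next
    case False
    then obtain x y where xy: "(x, y) \<in> Poly_Mapping.keys m"
      "\<forall>p q. (p, q) \<in> Poly_Mapping.keys m \<longrightarrow> q \<le> y" "\<forall>p. (p, y) \<in> Poly_Mapping.keys m \<longrightarrow> p \<le> x"
      using top_right_exists[of "Poly_Mapping.keys m"] by (metis finite_keys keys_eq_empty)
    have "Poly_Mapping.keys m' \<noteq> {}"
      using same_row[OF less.prems(1) xy(1)] by blast
    then obtain x' y' where xy': "(x', y') \<in> Poly_Mapping.keys m'"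
      "\<forall>p q. (p, q) \<in> Poly_Mapping.keys m' \<longrightarrow> q \<le> y'" "\<forall>p. (p, y') \<in> Poly_Mapping.keys m' \<longrightarrow> p \<le> x'"
      using top_right_exists[of "Poly_Mapping.keys m'"] by (metis finite_keys)
    have "y' = y"
      using same_row[OF less.prems(1) xy(1)] same_row[OF less.prems(1)[symmetric] xy'(1)] xy(2) xy'(2)
      by (meson le_antisym)
    note xy' = xy'[unfolded this]
    consider "x = x'" | "x < x'" | "x' < x"
      by linarith
    then show ?thesis
    proof cases
      case 1
      then show ?thesis
        using xy(1) xy'(1) less.prems by (intro common[of m m']) auto
    next
      case 2
      from swap[OF less.prems xy xy'(1) this] obtain n where n:
        "monomial_map row_run n = monomial_map row_run m'" "Poly_Mapping.keys n \<subseteq> V"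
        "(x', y) \<in> Poly_Mapping.keys n" "total_degree n = total_degree m"
        "monom m 1 - monom n 1 \<in> (polyomino_ideal P :: (point, 'k) mpoly set)"
        by blast
      have "(monom m 1 - monom n 1) + (monom n 1 - monom m' 1) \<in> (polyomino_ideal P :: (point, 'k) mpoly set)"
        using n less.prems xy'(1) by (intro poly_ideal_add[OF S n(5)] common[of n m'])
      then show ?thesis
        by simp
    next
      case 3
      from swap[OF less.prems(1)[symmetric] less.prems(3,2) xy' xy(1) this] obtain n where n:
        "monomial_map row_run n = monomial_map row_run m" "Poly_Mapping.keys n \<subseteq> V"
        "(x, y) \<in> Poly_Mapping.keys n"
        "monom m' 1 - monom n 1 \<in> (polyomino_ideal P :: (point, 'k) mpoly set)"
        by blast
      have "(monom m 1 - monom n 1) - (monom m' 1 - monom n 1) \<in> (polyomino_ideal P :: (point, 'k) mpoly set)"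
        using n less.prems xy(1) by (intro poly_ideal_diff[OF S _ n(4)] common[of m n]) auto
      then show ?thesis
        by simp
    qed
  qed
qed

lemma torus_kernel:
  fixes p :: "(point, 'k::field) mpoly"
  assumes p: "p \<in> carrier (poly_ring V)" "torus {(x, y). cell (x, y) \<in> P} p = 0"
  shows "p \<in> polyomino_ideal P"
proof -
  have "laurent row_run p = 0"
    using p(2) by (rule torus_factor) (auto simp: row_run_cell)
  then obtain \<rho> where \<rho>: "\<forall>m\<in>Poly_Mapping.keys p. \<rho> m \<in> Poly_Mapping.keys p \<and>
      monomial_map row_run (\<rho> m) = monomial_map row_run m"
    and sum: "p = (\<Sum>m\<in>Poly_Mapping.keys p.
      monom m (Poly_Mapping.lookup p m) - monom (\<rho> m) (Poly_Mapping.lookup p m))"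
    unfolding laurent_def by (blast dest: push_eq_0_binomials)
  note S = polyomino_ideal_ideal
  have "monom m c - monom (\<rho> m) c \<in> polyomino_ideal P"
    if "m \<in> Poly_Mapping.keys p" for m and c :: 'k
  proof -
    have "monom 0 c * (monom m 1 - monom (\<rho> m) 1) \<in> polyomino_ideal P"
    proof (intro poly_ideal_mult[OF S] straighten)
      show "monom 0 c \<in> carrier (poly_ring V)"
        by (simp add: poly_carrier_iff)
    qed (use p(1) \<rho> that in \<open>auto simp: poly_carrier_iff\<close>)
    then show ?thesis
      by (simp add: algebra_simps mult_single)
  qed
  then show ?thesis
    by (subst sum) (intro poly_ideal_sum[OF S])
qed

end

section \<open>The lexicographic order\<close>

text \<open>
  The variables are listed by increasing first and then decreasing second coordinate, and monomials
  are compared in the instance of \<^class>\<open>linorder\<close> of \<^theory>\<open>HOL-Library.Poly_Mapping\<close>, where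
  the variable with the smallest index decides.
\<close>

definition variable :: "nat \<Rightarrow> nat \<Rightarrow> point" where
  "variable M k = (k div M, M - 1 - k mod M)"

definition exponents :: "nat \<Rightarrow> point monomial \<Rightarrow> nat \<Rightarrow>\<^sub>0 nat" where
  "exponents M = Poly_Mapping.map_key (variable M)"

locale lex_order =
  fixes M :: nat
  assumes M_pos: "0 < M"
begin

lemma inj_variable: "inj (variable M)"
proof
  fix j k assume "variable M j = variable M k"
  then have "j div M = k div M" and eq: "M - 1 - j mod M = M - 1 - k mod M"
    by (simp_all only: variable_def prod.inject)
  moreover have "j mod M < M" "k mod M < M"
    using M_pos by auto
  with eq have "j mod M = k mod M"
    by linarith
  ultimately show "j = k"
    by (metis mult_div_mod_eq)
qed

definition index :: "nat \<Rightarrow> nat \<Rightarrow> nat" where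
  "index x y = x * M + (M - 1 - y)"

lemma variable_index:
  assumes "y < M"
  shows "variable M (index x y) = (x, y)"
proof -
  have "(x * M + c) div M = x \<and> (x * M + c) mod M = c" if "c < M" for c
    using that by simp
  from this[of "M - 1 - y"] show ?thesis
    unfolding variable_def index_def using assms M_pos by auto
qed

lemma variable_eq_iff: "y < M \<Longrightarrow> variable M k = (x, y) \<longleftrightarrow> k = index x y"
  using inj_variable variable_index by (metis injD)

lemma lookup_exponents: "Poly_Mapping.lookup (exponents M m) k = Poly_Mapping.lookup m (variable M k)"
  unfolding exponents_def by (simp add: Poly_Mapping.map_key.rep_eq[OF inj_variable])

lemma exponents_add: "exponents M (m + n) = exponents M m + exponents M n"
  unfolding exponents_def by (rule Poly_Mapping.map_key_plus[OF inj_variable])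

definition leads :: "(point, 'k::field) mpoly \<Rightarrow> point monomial \<Rightarrow> bool" where
  "leads p m \<longleftrightarrow> (\<exists>c p'. c \<noteq> 0 \<and> p = monom m c + p' \<and>
     (\<forall>k\<in>Poly_Mapping.keys p'. exponents M k < exponents M m))"

lemma leads_keys_le: "leads p m \<Longrightarrow> k \<in> Poly_Mapping.keys p \<Longrightarrow> exponents M k \<le> exponents M m"
  using Poly_Mapping.keys_add[of "monom m c" p' for c p'] unfolding leads_def
  by (fastforce split: if_splits)

lemma leads_mem_keys: "leads p m \<Longrightarrow> m \<in> Poly_Mapping.keys p"
  by (auto simp: leads_def in_keys_iff lookup_add)

lemma leads_1: "leads 1 0"
  unfolding leads_def by (intro exI[of _ 1] exI[of _ 0]) auto

lemma leads_var: "leads (var v) (monom v 1)"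
  unfolding leads_def var_def by (intro exI[of _ 1] exI[of _ 0]) auto

lemma leads_mult:
  assumes "leads p m" "leads q n"
  shows "leads (p * q) (m + n)"
proof -
  obtain c p' where p: "c \<noteq> 0" "p = monom m c + p'"
    "\<And>k. k \<in> Poly_Mapping.keys p' \<Longrightarrow> exponents M k < exponents M m"
    using assms(1) by (auto simp: leads_def)
  obtain d q' where q: "d \<noteq> 0" "q = monom n d + q'"
    "\<And>k. k \<in> Poly_Mapping.keys q' \<Longrightarrow> exponents M k < exponents M n"
    using assms(2) by (auto simp: leads_def)
  let ?r = "monom m c * q' + p' * q"
  have "p * q = monom (m + n) (c * d) + ?r"
    by (simp add: p(2) q(2) algebra_simps mult_single)
  moreover have "exponents M k < exponents M (m + n)" if "k \<in> Poly_Mapping.keys ?r" for k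
  proof -
    have "k \<in> Poly_Mapping.keys (monom m c * q') \<or> k \<in> Poly_Mapping.keys (p' * q)"
      using that Poly_Mapping.keys_add[of "monom m c * q'" "p' * q"] by blast
    then show ?thesis
    proof
      assume "k \<in> Poly_Mapping.keys (monom m c * q')"
      then obtain j where "k = m + j" "j \<in> Poly_Mapping.keys q'"
        using Poly_Mapping.keys_mult[of "monom m c" q'] by (auto split: if_splits)
      then show ?thesis
        using q(3) by (simp add: exponents_add)
    next
      assume "k \<in> Poly_Mapping.keys (p' * q)"
      then obtain i j where "k = i + j" "i \<in> Poly_Mapping.keys p'" "j \<in> Poly_Mapping.keys q"
        using Poly_Mapping.keys_mult[of p' q] by auto
      then show ?thesis
        using p(3) leads_keys_le[OF assms(2)] by (simp add: exponents_add add_less_le_mono)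
    qed
  qed
  ultimately show ?thesis
    using p(1) q(1) unfolding leads_def by (intro exI[of _ "c * d"] exI[of _ ?r]) auto
qed

lemma leads_diff:
  assumes "leads p m" "\<And>k. k \<in> Poly_Mapping.keys q \<Longrightarrow> exponents M k < exponents M m"
  shows "leads (p - q) m"
proof -
  obtain c p' where p: "c \<noteq> 0" "p = monom m c + p'"
    "\<And>k. k \<in> Poly_Mapping.keys p' \<Longrightarrow> exponents M k < exponents M m"
    using assms(1) by (auto simp: leads_def)
  have "p - q = monom m c + (p' - q)"
    by (simp add: p(2))
  moreover have "exponents M k < exponents M m" if "k \<in> Poly_Mapping.keys (p' - q)" for k
    using that keys_diff[of p' q] p(3) assms(2) by blast
  ultimately show ?thesis
    using p(1) unfolding leads_def by blast
qed

lemma leads_prod: "(\<And>i. i \<in> A \<Longrightarrow> leads (g i) (h i)) \<Longrightarrow> leads (prod g A) (sum h A)"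
  by (induction A rule: infinite_finite_induct) (auto intro: leads_1 leads_mult)

lemma exponents_diagonal_less:
  assumes "y < y'" "y' < M"
  shows "exponents M (monom (Suc x, y') 1 + monom (x, y) 1) < exponents M (monom (Suc x, y) 1 + monom (x, y') 1)"
    (is "exponents M ?p < exponents M ?q")
proof -
  define k where "k = index x y'"
  have "Poly_Mapping.lookup (exponents M ?p) k < Poly_Mapping.lookup (exponents M ?q) k"
    using assms by (simp add: lookup_exponents variable_index k_def lookup_add lookup_single)
  moreover have "Poly_Mapping.lookup (exponents M ?p) j = Poly_Mapping.lookup (exponents M ?q) j"
    if "j < k" for j
  proof -
    have "variable M j \<notin> {(x, y), (x, y'), (Suc x, y), (Suc x, y')}"
      using assms that by (auto simp: variable_eq_iff k_def index_def)
    then show ?thesis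
      by (auto simp: lookup_exponents lookup_add lookup_single when_def)
  qed
  ultimately show ?thesis
    unfolding less_poly_mapping.rep_eq less_fun_def by blast
qed

lemma hessenberg_leads:
  assumes "n \<le> b" "y \<le> b - n" "b < M"
  shows "leads (hessenberg a b n y :: (point, 'k::field) mpoly) ((\<Sum>i<n. monom (a + i, b - i) 1) + monom (a + n, y) 1)"
  using assms
proof (induction n arbitrary: y)
  case 0
  then show ?case
    using leads_var by simp
next
  case (Suc n)
  let ?s = "\<Sum>i<n. monom (a + i, b - i) (1 :: nat)"
  let ?m = "(\<Sum>i<Suc n. monom (a + i, b - i) 1) + monom (a + Suc n, y) 1"
  have "leads (var (a + Suc n, y) * hessenberg a b n (b - n) :: (point, 'k) mpoly)
      (monom (a + Suc n, y) 1 + (?s + monom (a + n, b - n) 1))"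
    using Suc.prems by (intro leads_mult leads_var Suc.IH) auto
  then have 1: "leads (var (a + Suc n, y) * hessenberg a b n (b - n) :: (point, 'k) mpoly) ?m"
    by (simp add: ac_simps)
  have 2: "leads (var (a + Suc n, b - n) * hessenberg a b n y :: (point, 'k) mpoly)
      (monom (a + Suc n, b - n) 1 + (?s + monom (a + n, y) 1))"
    using Suc.prems by (intro leads_mult leads_var Suc.IH) auto
  have "exponents M (monom (Suc (a + n), b - n) 1 + monom (a + n, y) 1)
      < exponents M (monom (Suc (a + n), y) 1 + monom (a + n, b - n) 1)"
    using Suc.prems by (intro exponents_diagonal_less) auto
  then have "exponents M ?s + exponents M (monom (Suc (a + n), b - n) 1 + monom (a + n, y) 1)
      < exponents M ?s + exponents M (monom (Suc (a + n), y) 1 + monom (a + n, b - n) 1)"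
    by (rule add_strict_left_mono)
  then have "exponents M (monom (a + Suc n, b - n) 1 + (?s + monom (a + n, y) 1)) < exponents M ?m"
    by (simp add: exponents_add ac_simps)
  then have "exponents M k < exponents M ?m" 
    if "k \<in> Poly_Mapping.keys (var (a + Suc n, b - n) * hessenberg a b n y :: (point, 'k) mpoly)" for k
    using leads_keys_le[OF 2 that] by (rule order.strict_trans1[rotated])
  then show ?case
    unfolding hessenberg.simps by (rule leads_diff[OF 1])
qed

definition lex :: "point set \<Rightarrow> point monomial rel" where
  "lex V = {(u, v). u \<in> monomials V \<and> v \<in> monomials V \<and> exponents M u \<le> exponents M v}"

lemma exponents_inj:
  assumes "\<And>x y. (x, y) \<in> V \<Longrightarrow> y < M" "u \<in> monomials V" "v \<in> monomials V" "exponents M u = exponents M v"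
  shows "u = v"
proof (rule poly_mapping_eqI)
  fix w :: point
  show "Poly_Mapping.lookup u w = Poly_Mapping.lookup v w"
  proof (cases "w \<in> V")
    case True
    obtain x y where w: "w = (x, y)"
      by (cases w)
    have "variable M (index x y) = w"
      using True assms(1) w by (simp add: variable_index)
    then show ?thesis
      using assms(4) by (metis lookup_exponents)
  next
    case False
    then have "w \<notin> Poly_Mapping.keys u" "w \<notin> Poly_Mapping.keys v"
      using assms(2,3) by (auto simp: monomials_def)
    then show ?thesis
      by (simp add: in_keys_iff)
  qed
qed

lemma monomials_add: "u \<in> monomials V \<Longrightarrow> v \<in> monomials V \<Longrightarrow> u + v \<in> monomials V"
  by (simp add: monomials_def keys_monomial_add)

lemma exponents_0_le: "exponents M 0 \<le> exponents M u"
proof (cases "exponents M u = 0")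
  case False
  define p where "p = exponents M u"
  define k where "k = (LEAST k. Poly_Mapping.lookup p k \<noteq> 0)"
  obtain j where "Poly_Mapping.lookup p j \<noteq> 0"
    using False poly_mapping_eqI[of p 0] by (auto simp: p_def)
  then have "Poly_Mapping.lookup p k \<noteq> 0"
    unfolding k_def by (rule LeastI)
  moreover have "Poly_Mapping.lookup p j = 0" if "j < k" for j
    using not_less_Least[OF that[unfolded k_def]] by simp
  ultimately have "0 < p"
    unfolding less_poly_mapping.rep_eq less_fun_def by (intro exI[of _ k]) auto
  moreover have "exponents M 0 = 0"
    by (rule poly_mapping_eqI) (simp add: lookup_exponents)
  ultimately show ?thesis
    by (simp add: p_def)
qed (metis add_0 add_cancel_left_left exponents_add order_refl)

lemma lex_monomial_order:
  assumes "\<And>x y. (x, y) \<in> V \<Longrightarrow> y < M"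
  shows "monomial_order V (lex V)"
  unfolding monomial_order_def
proof (intro conjI ballI allI impI)
  show "linear_order_on (monomials V) (lex V)"
    unfolding linear_order_on_def partial_order_on_def preorder_on_def
    by (auto simp: lex_def refl_on_def trans_def antisym_def total_on_def
        intro: exponents_inj[OF assms])
  show "(0, u) \<in> lex V" if "u \<in> monomials V" for u
    using that by (simp add: lex_def exponents_0_le) (simp add: monomials_def)
  show "(u + w, v + w) \<in> lex V" if "w \<in> monomials V" "(u, v) \<in> lex V" for u v w
    using that by (simp add: lex_def monomials_add exponents_add add_right_mono)
qed

lemma initial_monomial_lex:
  assumes V: "\<And>x y. (x, y) \<in> V \<Longrightarrow> y < M"
    and "leads p m" "p \<in> carrier (poly_ring V)"
  shows "initial_monomial (lex V) p = m"
  unfolding initial_monomial_def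
proof (rule the_equality)
  have keys: "Poly_Mapping.keys p \<subseteq> monomials V"
    using assms(3) by (simp add: poly_ring_def)
  show m: "m \<in> Poly_Mapping.keys p \<and> (\<forall>v\<in>Poly_Mapping.keys p. (v, m) \<in> lex V)"
    using leads_mem_keys[OF assms(2)] leads_keys_le[OF assms(2)] keys by (auto simp: lex_def)
  fix u assume u: "u \<in> Poly_Mapping.keys p \<and> (\<forall>v\<in>Poly_Mapping.keys p. (v, u) \<in> lex V)"
  then have "(m, u) \<in> lex V" "(u, m) \<in> lex V"
    using m by auto
  then show "u = m"
    using exponents_inj[of V u m] V by (auto simp: lex_def)
qed

end

section \<open>The product of the chain determinants\<close>

lemma squarefree_sum_inj:
  assumes "finite A" "inj_on h A"
  shows "squarefree_monomial (\<Sum>i\<in>A. monom (h i) 1)"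
  unfolding squarefree_monomial_def
proof
  fix w
  have "(\<Sum>i\<in>A. Poly_Mapping.lookup (monom (h i) (1 :: nat)) w)
      = (\<Sum>v\<in>h ` A. Poly_Mapping.lookup (monom v (1 :: nat)) w)"
    using assms(2) by (simp add: sum.reindex)
  also have "\<dots> = (\<Sum>v\<in>h ` A. if v = w then 1 else 0)"
    by (rule sum.cong) (auto simp: lookup_single)
  also have "\<dots> \<le> 1"
    using assms(1) by (subst sum.delta) auto
  finally show "Poly_Mapping.lookup (\<Sum>i\<in>A. monom (h i) (1 :: nat)) w \<le> 1"
    by (simp only: lookup_sum)
qed

context ladder_cells
begin

definition chain_starts :: "point set" where
  "chain_starts = {(a, b). (a, b) \<in> V \<and> cell (a - 1, b) \<notin> P}"

definition chain_length :: "nat \<Rightarrow> nat \<Rightarrow> nat" where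
  "chain_length a b = (LEAST n. cell (a + n, b - Suc n) \<notin> P)"

definition chain_poly :: "(point, 'k::field) mpoly" where
  "chain_poly = (\<Prod>(a, b)\<in>chain_starts. hessenberg a b (chain_length a b) (b - chain_length a b))"

lemma finite_chain_starts: "finite chain_starts"
  by (rule finite_subset[OF _ finite_V]) (auto simp: chain_starts_def)

lemma chain_length_end: "cell (a + chain_length a b, b - Suc (chain_length a b)) \<notin> P"
  unfolding chain_length_def
proof (rule LeastI)
  show "cell (a + b, b - Suc b) \<notin> P"
    using cell_pos[of "a + b" "b - Suc b"] by auto
qed

lemma chain_chain_length: "(a, b) \<in> V \<Longrightarrow> chain a b (chain_length a b)"
  unfolding chain_def chain_length_def by (blast dest: not_less_Least)

lemma less_chain_length:
  assumes "\<And>i. i \<le> j \<Longrightarrow> cell (a + i, b - Suc i) \<in> P"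
  shows "j < chain_length a b"
  using assms chain_length_end[of a b] by (meson not_less)

lemma chain_start_exists:
  assumes "cell (x, y) \<in> P"
  shows "\<exists>a b j. (a, b) \<in> chain_starts \<and> x = a + j \<and> y = b - Suc j \<and>
    (\<forall>i\<le>j. cell (a + i, b - Suc i) \<in> P)"
  using assms
proof (induction x arbitrary: y)
  case 0
  then show ?case
    using cell_pos by blast
next
  case (Suc x)
  show ?case
  proof (cases "cell (x, Suc y) \<in> P")
    case True
    then obtain a b j where abj: "(a, b) \<in> chain_starts" "x = a + j" "Suc y = b - Suc j"
      "\<forall>i\<le>j. cell (a + i, b - Suc i) \<in> P"
      using Suc.IH by blast
    have y: "y = b - Suc (Suc j)"
      using abj(3) by simp
    have "cell (a + Suc j, b - Suc (Suc j)) \<in> P"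
      using Suc.prems unfolding y abj(2) by simp
    then have "\<forall>i\<le>Suc j. cell (a + i, b - Suc i) \<in> P"
      using abj(4) by (metis le_Suc_eq)
    then show ?thesis
      using abj(1,2) y by (intro exI[of _ a] exI[of _ b] exI[of _ "Suc j"]) simp
  next
    case False
    then have "(Suc x, Suc y) \<in> chain_starts"
      using cell_vertices[OF Suc.prems] by (simp add: chain_starts_def)
    then show ?thesis
      using Suc.prems by (intro exI[of _ "Suc x"] exI[of _ "Suc y"] exI[of _ 0]) auto
  qed
qed

lemma chain_poly_carrier: "(chain_poly :: (point, 'k::field) mpoly) \<in> carrier (poly_ring V)"
  unfolding chain_poly_def
  by (intro poly_carrier_prod)
    (auto simp: chain_starts_def intro!: chain_hessenberg_carrier chain_chain_length)

lemma chain_factors_chain_poly: "chain_factors (chain_poly :: (point, 'k::field) mpoly)"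
  unfolding chain_factors_def
proof (intro allI impI)
  fix x y assume "cell (x, y) \<in> P"
  from chain_start_exists[OF this] obtain a b j where s: "(a, b) \<in> chain_starts" "x = a + j" "y = b - Suc j"
    "\<forall>i\<le>j. cell (a + i, b - Suc i) \<in> P"
    by blast
  let ?h = "\<lambda>(a, b). hessenberg a b (chain_length a b) (b - chain_length a b) :: (point, 'k) mpoly"
  let ?g = "\<Prod>s\<in>chain_starts - {(a, b)}. ?h s"
  have "chain_poly = hessenberg a b (chain_length a b) (b - chain_length a b) * ?g"
    unfolding chain_poly_def using prod.remove[OF finite_chain_starts s(1), of ?h] by simp
  moreover have "?g \<in> carrier (poly_ring V)"
    by (intro poly_carrier_prod)
      (auto simp: chain_starts_def intro!: chain_hessenberg_carrier chain_chain_length)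
  moreover have "j < chain_length a b"
    using s(4) by (intro less_chain_length) auto
  moreover have "chain a b (chain_length a b)"
    using s(1) by (intro chain_chain_length) (auto simp: chain_starts_def)
  ultimately show "\<exists>a b n j g. chain a b n \<and> j < n \<and> x = a + j \<and> y = b - Suc j \<and>
      g \<in> carrier (poly_ring V) \<and> (chain_poly :: (point, 'k) mpoly) = hessenberg a b n (b - n) * g"
    using s(2,3) by blast
qed

lemma chains_disjoint:
  assumes "(a, b) \<in> chain_starts" "(a', b') \<in> chain_starts" "i' \<le> chain_length a' b'" "i < i'"
    and "a + i = a' + i'" "b - i = b' - i'" "i < b"
  shows False
proof -
  define d where "d = i' - Suc i"
  have ch: "chain a' b' (chain_length a' b')"
    using assms(2) by (intro chain_chain_length) (auto simp: chain_starts_def)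
  have "d < chain_length a' b'"
    using assms(3,4) by (simp add: d_def)
  then have "cell (a' + d, b' - Suc d) \<in> P"
    using ch by (simp add: chain_def)
  moreover have "a' + d = a - 1" "b' - Suc d = b"
    using assms(3-7) chain_less[OF ch] by (auto simp: d_def)
  ultimately show False
    using assms(1) by (simp add: chain_starts_def)
qed

lemma inj_on_chain_vertices:
  "inj_on (\<lambda>((a, b), i). (a + i, b - i)) (Sigma chain_starts (\<lambda>(a, b). {..chain_length a b}))"
proof (rule inj_onI, clarsimp)
  fix a b i a' b' i'
  assume s: "(a, b) \<in> chain_starts" "(a', b') \<in> chain_starts"
    and i: "i \<le> chain_length a b" "i' \<le> chain_length a' b'"
    and eq: "a + i = a' + i'" "b - i = b' - i'"
  have "i < b" "i' < b'"
    using i s chain_less[OF chain_chain_length, of a b] chain_less[OF chain_chain_length, of a' b']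
    by (auto simp: chain_starts_def)
  moreover have "i = i'"
    using chains_disjoint[OF s i(2) _ eq] chains_disjoint[OF s(2,1) i(1) _ eq[symmetric]] calculation
    by (meson linorder_neqE_nat)
  ultimately show "a = a' \<and> b = b' \<and> i = i'"
    using eq by auto
qed

lemma chain_poly_leads:
  assumes "0 < M" "\<And>x y. (x, y) \<in> V \<Longrightarrow> y < M"
  shows "lex_order.leads M (chain_poly :: (point, 'k::field) mpoly)
    (\<Sum>((a, b), i)\<in>Sigma chain_starts (\<lambda>(a, b). {..chain_length a b}). monom (a + i, b - i) 1)"
proof -
  interpret lex_order M
    using \<open>0 < M\<close> by unfold_locales
  have h: "leads (hessenberg a b (chain_length a b) (b - chain_length a b) :: (point, 'k) mpoly)
      (\<Sum>i\<le>chain_length a b. monom (a + i, b - i) 1)" if "(a, b) \<in> chain_starts" for a b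
  proof -
    have "(a, b) \<in> V"
      using that by (simp add: chain_starts_def)
    then show ?thesis
      using hessenberg_leads[of "chain_length a b" b "b - chain_length a b" a]
        chain_less[OF chain_chain_length[of a b]] assms
      by (simp flip: lessThan_Suc_atMost)
  qed
  have "leads (chain_poly :: (point, 'k) mpoly)
      (\<Sum>(a, b)\<in>chain_starts. \<Sum>i\<le>chain_length a b. monom (a + i, b - i) 1)"
    unfolding chain_poly_def by (intro leads_prod) (use h in auto)
  then show ?thesis
    by (subst sum.Sigma[symmetric]) (auto simp: finite_chain_starts case_prod_unfold)
qed

lemma knutson_polyomino_ideal:
  assumes "P \<noteq> {}"
  shows "knutson_ideal V (polyomino_ideal P :: (point, 'k::field) mpoly set)"
proof -
  obtain M where M: "\<forall>n\<in>snd ` V. n < M"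
    using finite_nat_set_iff_bounded finite_imageI[OF finite_V] by metis
  obtain C where "C \<in> P"
    using assms by blast
  then obtain a where "cell a \<in> P"
    using P_cells by blast
  then have "(fst a, snd a) \<in> V"
    by (intro cell_vertices) simp
  then have "0 < M"
    using M by fastforce
  then interpret lex_order M
    by unfold_locales
  have y: "y < M" if "(x, y) \<in> V" for x y
    using M that by force
  let ?S = "Sigma chain_starts (\<lambda>(a, b). {..chain_length a b})"
  let ?m = "\<Sum>((a, b), i)\<in>?S. monom (a + i, b - i) (1 :: nat)"
  let ?f = "chain_poly :: (point, 'k) mpoly"
  have leads: "leads ?f ?m"
    using \<open>0 < M\<close> y by (rule chain_poly_leads)
  have "finite ?S"
    by (intro finite_SigmaI finite_chain_starts) auto
  from squarefree_sum_inj[OF this inj_on_chain_vertices] have "squarefree_monomial ?m"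
    by (simp add: case_prod_unfold)
  moreover have "initial_monomial (lex V) ?f = ?m"
    using y leads chain_poly_carrier by (rule initial_monomial_lex)
  moreover have "?f \<noteq> 0"
    using leads_mem_keys[OF leads] by auto
  moreover have "polyomino_ideal P \<in> knutson_class (poly_ring V) ?f"
    using chain_poly_carrier \<open>?f \<noteq> 0\<close> chain_factors_chain_poly assms torus_kernel
    by (rule polyomino_ideal_knutson_class)
  moreover have "monomial_order V (lex V)"
    using y by (rule lex_monomial_order)
  ultimately show ?thesis
    unfolding knutson_ideal_def using chain_poly_carrier by (intro exI[of _ ?f] exI[of _ "lex V"]) simp
qed

end

section \<open>Ladder polyominoes\<close>

lemma cell_inj: "cell a = cell b \<Longrightarrow> a = b"
proof -
  assume "cell a = cell b"
  moreover have "a \<in> cell a" "b \<in> cell b"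
    by (auto simp: cell_eq)
  ultimately have "a \<in> cell b" "b \<in> cell a"
    by auto
  then show "a = b"
    by (auto simp: cell_def intro: antisym)
qed

lemma ladder_left_cell:
  assumes "ladder_polyomino P" "(x, y) \<in> vertices P" "(u, w) \<in> vertices P" "w < y"
  shows "\<exists>x0\<le>x. cell (x0, y - 1) \<in> P"
proof -
  obtain as where as: "leftmost_vertices P as" and ladder: "\<And>i. 1 \<le> i \<Longrightarrow> i < length as \<Longrightarrow>
      \<exists>b. cell b \<in> P \<and> as ! i = upper_left b (b + (1, 1))"
    using assms(1) unfolding ladder_polyomino_def by blast
  have left: "\<exists>i<length as. \<exists>x0\<le>x. as ! i = (x0, y)" if "(x, y) \<in> vertices P" for x y
  proof -
    have "(x, y) \<in> set as \<or> (\<exists>a\<in>set as. snd (x, y) = snd a \<and> fst a < fst (x, y))"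
      using as that unfolding leftmost_vertices_def by blast
    then have "\<exists>x0\<le>x. (x0, y) \<in> set as"
      by (metis fst_conv less_imp_le order_refl prod.collapse snd_conv)
    then show ?thesis
      by (metis in_set_conv_nth)
  qed
  obtain i x0 where i: "i < length as" "x0 \<le> x" "as ! i = (x0, y)"
    using left[OF assms(2)] by blast
  obtain j u0 where j: "j < length as" "as ! j = (u0, w)"
    using left[OF assms(3)] by blast
  have "i \<noteq> 0"
  proof
    assume "i = 0"
    moreover have "i \<noteq> j"
      using i(3) j(2) assms(4) by auto
    ultimately have "snd (as ! i) < snd (as ! j)"
      using as j(1) unfolding leftmost_vertices_def by (auto simp: sorted_wrt_iff_nth_less)
    then show False
      using i(3) j(2) assms(4) by simp
  qed
  then obtain b where "cell b \<in> P" "as ! i = upper_left b (b + (1, 1))"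
    using ladder[of i] i(1) by auto
  then have "cell (x0, y - 1) \<in> P"
    using i(3) by (cases b) (auto simp: upper_left_def)
  then show ?thesis
    using i(2) by blast
qed

lemma ladder_left_cell_below:
  assumes "ladder_polyomino P" "(x, y) \<in> vertices P" "cell (x', q) \<in> P" "q < y"
  shows "\<exists>x0\<le>x. cell (x0, q) \<in> P"
  using assms(2,4)
proof (induction y arbitrary: x)
  case (Suc y)
  have "(x', q) \<in> vertices P"
    using assms(3) by (auto simp: vertices_def cell_eq)
  then obtain x1 where x1: "x1 \<le> x" "cell (x1, y) \<in> P"
    using ladder_left_cell[OF assms(1) Suc.prems(1)] Suc.prems(2) by auto
  show ?case
  proof (cases "q = y")
    case True
    then show ?thesis
      using x1 by blast
  next
    case False
    have "(x1, y) \<in> vertices P"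
      using x1(2) by (auto simp: vertices_def cell_eq)
    then show ?thesis
      using Suc.IH[of x1] Suc.prems(2) False x1(1) by (meson le_trans less_SucE)
  qed
qed simp

lemma ladder_polyomino_ladder_cells:
  assumes "ladder_polyomino P"
  shows "ladder_cells P"
proof
  have poly: "finite P" "P \<subseteq> cell ` {(1, 1)..}"
    using assms by (auto simp: ladder_polyomino_def polyomino_def)
  show "finite P"
    by (rule poly)
  show "\<exists>a. C = cell a" if "C \<in> P" for C
    using poly(2) that by blast
  show "0 < x \<and> 0 < y" if "cell (x, y) \<in> P" for x y
    using poly(2) that by (auto dest!: cell_inj subsetD)
  show "cell (p, q) \<in> P"
    if lad: "(x, y) \<in> vertices P" "cell (x', q) \<in> P" "q < y" "x \<le> p" "p \<le> x'" for x y x' q p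
  proof -
    obtain x0 where x0: "x0 \<le> x" "cell (x0, q) \<in> P"
      using ladder_left_cell_below[OF assms lad(1-3)] by blast
    show ?thesis
    proof (cases "x0 = x'")
      case True
      then have "p = x'"
        using x0(1) lad by simp
      then show ?thesis
        using lad(2) by simp
    next
      case False
      then have "x0 < x'" "p \<in> {x0..x'}"
        using x0(1) lad by auto
      moreover have "horizontally_convex P"
        using assms by (simp add: ladder_polyomino_def)
      ultimately show ?thesis
        using x0(2) lad(2) unfolding horizontally_convex_def by blast
    qed
  qed
qed

theorem theorem4p1:
  fixes P :: "point set set"
  assumes "ladder_polyomino P"
  shows "knutson_ideal (vertices P) (polyomino_ideal P :: (point, 'k :: field) mpoly set)"
proof -
  interpret ladder_cells P
    using assms by (rule ladder_polyomino_ladder_cells)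
  show ?thesis
    using assms by (intro knutson_polyomino_ideal) (auto simp: ladder_polyomino_def polyomino_def)
qed

end
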